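(* Let $h\ge1$, let $n,d_0,d_1,\dots,d_h$ be positive integers, and let $X\in\mathbb{R}^{d_0\times n}$ and $Y\in\mathbb{R}^{d_h\times n}$ be arbitrary matrices. Consider the deep linear network problem $$\min_{W=(W_h,\dots,W_1)}\ \tfrac12\|W_h\cdots W_1X-Y\|^2,\qquad W_i\in\mathbb{R}^{d_i\times d_{i-1}} .$$ If there do not exist $p_1$ and $p_2$ with $1\le p_1<p_2\le h-1$, $d_h>d_{p_2}$ and $d_0>d_{p_1}$, then every local minimum of this problem is a global minimum.
   Context: $\|\cdot\|$ is the Frobenius norm. *)

theory Defs
  imports Complex_Main "Jordan_Normal_Form.Matrix"
begin

definition frob_norm :: "real mat \<Rightarrow> real" where
  "frob_norm A = sqrt (\<Sum>i<dim_row A. \<Sum>j<dim_col A. (A $$ (i, j))\<^sup>2)"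

text \<open>Parameters are families \<open>W :: nat \<Rightarrow> real mat\<close> of which only the entries with index in
  \<open>{1..h}\<close> are meaningful; the values of \<open>W\<close> at other indices are never inspected below.\<close>

definition dln_params :: "nat \<Rightarrow> (nat \<Rightarrow> nat) \<Rightarrow> (nat \<Rightarrow> real mat) set" where
  "dln_params h d = {W. \<forall>i\<in>{1..h}. W i \<in> carrier_mat (d i) (d (i - 1))}"

text \<open>\<open>dln_output W h X\<close> is the product \<open>W h * \<dots> * W 1 * X\<close>, bracketed to the right.\<close>

primrec dln_output :: "(nat \<Rightarrow> real mat) \<Rightarrow> nat \<Rightarrow> real mat \<Rightarrow> real mat" where
  "dln_output W 0 X = X"
| "dln_output W (Suc k) X = W (Suc k) * dln_output W k X"

definition dln_loss :: "nat \<Rightarrow> real mat \<Rightarrow> real mat \<Rightarrow> (nat \<Rightarrow> real mat) \<Rightarrow> real" where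
  "dln_loss h X Y W = (1 / 2) * (frob_norm (dln_output W h X - Y))\<^sup>2"

text \<open>Euclidean distance on the product of the matrix spaces.\<close>

definition dln_dist :: "nat \<Rightarrow> (nat \<Rightarrow> real mat) \<Rightarrow> (nat \<Rightarrow> real mat) \<Rightarrow> real" where
  "dln_dist h V W = sqrt (\<Sum>i = 1..h. (frob_norm (V i - W i))\<^sup>2)"

definition dln_local_min ::
    "nat \<Rightarrow> (nat \<Rightarrow> nat) \<Rightarrow> real mat \<Rightarrow> real mat \<Rightarrow> (nat \<Rightarrow> real mat) \<Rightarrow> bool" where
  "dln_local_min h d X Y W \<longleftrightarrow>
     W \<in> dln_params h d \<and>
     (\<exists>\<epsilon>>0. \<forall>V\<in>dln_params h d. dln_dist h V W < \<epsilon> \<longrightarrow> dln_loss h X Y W \<le> dln_loss h X Y V)"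

definition dln_global_min ::
    "nat \<Rightarrow> (nat \<Rightarrow> nat) \<Rightarrow> real mat \<Rightarrow> real mat \<Rightarrow> (nat \<Rightarrow> real mat) \<Rightarrow> bool" where
  "dln_global_min h d X Y W \<longleftrightarrow>
     W \<in> dln_params h d \<and> (\<forall>V\<in>dln_params h d. dln_loss h X Y W \<le> dln_loss h X Y V)"

end

theory Submission
  imports Defs "Jordan_Normal_Form.Char_Poly"
begin

text \<open>
  Write \<open>M = W\<^sub>h \<cdots> W\<^sub>1\<close> for the end-to-end matrix, \<open>G = (M X - Y) X\<^sup>T\<close> for the gradient of the
  loss with respect to \<open>M\<close>, \<open>L\<^sub>j = W\<^sub>h \<cdots> W\<^bsub>j+1\<^esub>\<close> for the tail and \<open>R\<^sub>j = W\<^sub>j \<cdots> W\<^sub>1\<close> for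
  the head of the network. The loss is convex in \<open>M\<close>, so \<open>G = 0\<close> already makes a local minimum
  global. What has to be understood is how \<open>G = 0\<close> can fail.

  The first tool is a \<^emph>\<open>flat move\<close>: if \<open>L\<^sub>j b = 0\<close>, replacing \<open>W\<^sub>j\<close> by \<open>W\<^sub>j + t b s\<^sup>T\<close> changes no
  tail and not \<open>M\<close>, so for small \<open>t\<close> it leads from a local minimum to another local minimum with
  the same gradient. Let \<open>k\<close> be the first index for which \<open>L\<^sub>k\<close> has a right inverse. Criticality in
  \<open>W\<^sub>k\<close> gives \<open>G R\<^bsub>k-1\<^esub>\<^sup>T = 0\<close>. If \<open>G R\<^sub>j\<^sup>T = 0\<close> is known at all such local minima and \<open>L\<^sub>j\<close> has a
  kernel, comparing the identity before and after a flat move gives \<open>G R\<^bsub>j-1\<^esub>\<^sup>T = 0\<close>. Hence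
  \<open>G = 0\<close> as soon as every \<open>L\<^sub>j\<close> with \<open>1 \<le> j < k\<close> has a kernel
  (\<open>gradient_zero_if_tails_degenerate\<close>). Transposing the whole network gives the
  same statement for the heads (\<open>gradient_zero_if_heads_degenerate\<close>).

  The hypothesis on the widths leaves three cases (\<open>bottleneck_cases\<close>). If all hidden layers
  are at least as wide as the output, each tail has a kernel or a right inverse, and the first tool
  applies; if all are at least as wide as the input, its transposed form applies. Otherwise there is a
  single bottleneck \<open>p\<close> with \<open>d\<^sub>p < min d\<^sub>0 d\<^sub>h\<close>, all layers before it at least as wide as the
  input and all layers after it at least as wide as the output. If \<open>L\<^sub>p\<close> has a kernel, so has every
  earlier tail, because it factors through the narrow layer, and the later tails are covered by
  their widths; again \<open>G = 0\<close>. A kernel of \<open>R\<^sub>p\<^sup>T\<close> has the same consequence by transposition.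

  There remains the case in which \<open>A = L\<^sub>p\<close> has a left and \<open>B = R\<^sub>p\<close> a right inverse, where
  \<open>G \<noteq> 0\<close> is possible. Moving \<open>W\<^sub>h\<close> and \<open>W\<^sub>1\<close> alone realises every variation of \<open>A\<close> and \<open>B\<close>, so
  \<open>(A, B)\<close> behaves like a local minimum of the two-layer problem. For that problem first and
  second order conditions suffice: rank-one variations show that the part of the residual orthogonal
  to \<open>A\<close>, restricted to the row space of \<open>X\<close>, has no singular value above the \<open>d\<^sub>p\<close> leading ones of
  \<open>A B X\<close> (\<open>gradient_singular_value_bound\<close>), and an argument of Eckart-Young type turns this into
  global optimality (\<open>two_layer_minimum_is_global\<close>).
\<close>

section \<open>Matrix algebra and the Frobenius inner product\<close>

text \<open>
  The ring laws below have side conditions on dimensions instead of membership in a carrier: these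
  contain no variables beyond those of the left-hand side, so the simplifier can discharge them once
  the dimensions of the matrices at hand are simplification rules.
\<close>

lemma mult_assoc_dim: "dim_col A = dim_row B \<Longrightarrow> dim_col B = dim_row C \<Longrightarrow> A * B * C = A * (B * (C :: real mat))"
  by (rule assoc_mult_mat[of A "dim_row A" "dim_col A" B "dim_col B" C "dim_col C"]) auto

lemma add_mult_distrib_dim:
  "dim_row A = dim_row B \<Longrightarrow> dim_col A = dim_row C \<Longrightarrow> dim_col B = dim_row C \<Longrightarrow> (A + B) * C = A * C + B * (C :: real mat)"
  by (rule add_mult_distrib_mat[of A "dim_row A" "dim_col A" B C "dim_col C"]) auto

lemma mult_add_distrib_dim:
  "dim_col A = dim_row B \<Longrightarrow> dim_row B = dim_row C \<Longrightarrow> dim_col B = dim_col C \<Longrightarrow> A * (B + C) = A * B + A * (C :: real mat)"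
  by (rule mult_add_distrib_mat[of A "dim_row A" "dim_col A" B "dim_col B" C]) auto

lemma minus_mult_distrib_dim:
  "dim_row A = dim_row B \<Longrightarrow> dim_col A = dim_row C \<Longrightarrow> dim_col B = dim_row C \<Longrightarrow> (A - B) * C = A * C - B * (C :: real mat)"
  by (rule minus_mult_distrib_mat[of A "dim_row A" "dim_col A" B C "dim_col C"]) auto

lemma mult_minus_distrib_dim:
  "dim_col A = dim_row B \<Longrightarrow> dim_row B = dim_row C \<Longrightarrow> dim_col B = dim_col C \<Longrightarrow> A * (B - C) = A * B - A * (C :: real mat)"
  by (rule mult_minus_distrib_mat[of A "dim_row A" "dim_col A" B "dim_col B" C]) auto

lemma smult_mult_dim: "dim_col A = dim_row B \<Longrightarrow> (k \<cdot>\<^sub>m A) * B = k \<cdot>\<^sub>m (A * (B :: real mat))"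
  by (rule mult_smult_assoc_mat[of A "dim_row A" "dim_col A" B "dim_col B"]) auto

lemma mult_smult_dim: "dim_col A = dim_row B \<Longrightarrow> A * (k \<cdot>\<^sub>m B) = k \<cdot>\<^sub>m (A * (B :: real mat))"
  by (rule mult_smult_distrib[of A "dim_row A" "dim_col A" B "dim_col B"]) auto

lemma transpose_mult_dim: "dim_col A = dim_row B \<Longrightarrow> (A * B)\<^sup>T = B\<^sup>T * (A\<^sup>T :: real mat)"
  by (rule transpose_mult[of A "dim_row A" "dim_col A" B "dim_col B"]) auto

lemma transpose_add_dim: "dim_row A = dim_row B \<Longrightarrow> dim_col A = dim_col B \<Longrightarrow> (A + B)\<^sup>T = A\<^sup>T + (B\<^sup>T :: real mat)"
  by (rule eq_matI) auto
lemma transpose_minus_dim: "dim_row A = dim_row B \<Longrightarrow> dim_col A = dim_col B \<Longrightarrow> (A - B)\<^sup>T = A\<^sup>T - (B\<^sup>T :: real mat)"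
  by (rule eq_matI) auto
lemma transpose_smult_dim: "(k \<cdot>\<^sub>m A)\<^sup>T = k \<cdot>\<^sub>m (A\<^sup>T :: real mat)"
  by (rule eq_matI) auto

lemma one_mult_dim: "n = dim_row A \<Longrightarrow> 1\<^sub>m n * A = (A :: real mat)"
  by auto
lemma mult_one_dim: "n = dim_col A \<Longrightarrow> A * 1\<^sub>m n = (A :: real mat)"
  by auto
lemma zero_mult_dim: "m = dim_row A \<Longrightarrow> 0\<^sub>m n m * A = 0\<^sub>m n (dim_col (A :: real mat))"
  by (rule eq_matI) (auto simp: scalar_prod_def)
lemma mult_zero_dim: "m = dim_col A \<Longrightarrow> A * 0\<^sub>m m n = 0\<^sub>m (dim_row A) n" for A :: "real mat"
  by (rule eq_matI) (auto simp: scalar_prod_def)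

lemma add_zero_dim: "m = dim_row A \<Longrightarrow> n = dim_col A \<Longrightarrow> A + 0\<^sub>m m n = (A :: real mat)"
  by (intro eq_matI) auto
lemma zero_add_dim: "m = dim_row A \<Longrightarrow> n = dim_col A \<Longrightarrow> 0\<^sub>m m n + A = (A :: real mat)"
  by (intro eq_matI) auto
lemma smult_smult: "k \<cdot>\<^sub>m (l \<cdot>\<^sub>m A) = (k * l) \<cdot>\<^sub>m (A :: real mat)"
  by (intro eq_matI) auto

lemma minus_self: "A - A = 0\<^sub>m (dim_row A) (dim_col (A :: real mat))"
  by (intro eq_matI) auto

lemmas mat_dim = mult_assoc_dim add_mult_distrib_dim mult_add_distrib_dim minus_mult_distrib_dim
  mult_minus_distrib_dim smult_mult_dim mult_smult_dim one_mult_dim mult_one_dim zero_mult_dim mult_zero_dim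

lemmas trans_dim = transpose_mult_dim transpose_add_dim transpose_minus_dim transpose_smult_dim

text \<open>
  Meant for two matrices of the same shape. Column vectors are represented as matrices with one
  column throughout, and on them this is the standard scalar product.
\<close>

definition frob_inner :: "real mat \<Rightarrow> real mat \<Rightarrow> real" where
  "frob_inner A B = (\<Sum>i<dim_row A. \<Sum>j<dim_col A. A $$ (i, j) * B $$ (i, j))"

lemma frob_norm_sq: "(frob_norm A)\<^sup>2 = frob_inner A A"
  unfolding frob_norm_def frob_inner_def
  by (simp add: sum_nonneg power2_eq_square)

lemma frob_inner_nonneg [simp]: "0 \<le> frob_inner A A"
  unfolding frob_inner_def by (intro sum_nonneg) auto

lemma frob_inner_eq_0: "frob_inner A A = 0 \<Longrightarrow> A = 0\<^sub>m (dim_row A) (dim_col A)"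
  unfolding frob_inner_def
  by (rule eq_matI) (auto simp: sum_nonneg_eq_0_iff sum_nonneg)

lemma frob_inner_add_left: "dim_row A = dim_row B \<Longrightarrow> dim_col A = dim_col B \<Longrightarrow> frob_inner (A + B) C = frob_inner A C + frob_inner B C"
  unfolding frob_inner_def by (simp add: sum.distrib distrib_right)
lemma frob_inner_minus_left: "dim_row A = dim_row B \<Longrightarrow> dim_col A = dim_col B \<Longrightarrow> frob_inner (A - B) C = frob_inner A C - frob_inner B C"
  unfolding frob_inner_def by (simp add: sum_subtractf left_diff_distrib)
lemma frob_inner_smult_left: "frob_inner (k \<cdot>\<^sub>m A) C = k * frob_inner A C"
  unfolding frob_inner_def by (simp add: sum_distrib_left mult.assoc)
lemma frob_inner_commute: "dim_row A = dim_row B \<Longrightarrow> dim_col A = dim_col B \<Longrightarrow> frob_inner A B = frob_inner B A"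
  unfolding frob_inner_def by (simp add: mult.commute)
lemma frob_inner_add_right: "dim_row A = dim_row B \<Longrightarrow> dim_col A = dim_col B \<Longrightarrow> dim_row B = dim_row C \<Longrightarrow> dim_col B = dim_col C
   \<Longrightarrow> frob_inner A (B + C) = frob_inner A B + frob_inner A C"
  unfolding frob_inner_def by (simp add: sum.distrib distrib_left)
lemma frob_inner_minus_right: "dim_row A = dim_row B \<Longrightarrow> dim_col A = dim_col B \<Longrightarrow> dim_row B = dim_row C \<Longrightarrow> dim_col B = dim_col C
   \<Longrightarrow> frob_inner A (B - C) = frob_inner A B - frob_inner A C"
  unfolding frob_inner_def by (simp add: sum_subtractf right_diff_distrib)
lemma frob_inner_smult_right: "dim_row A = dim_row B \<Longrightarrow> dim_col A = dim_col B \<Longrightarrow> frob_inner A (k \<cdot>\<^sub>m B) = k * frob_inner A B"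
  unfolding frob_inner_def by (simp add: sum_distrib_left mult.left_commute)
lemma frob_inner_zero_left: "frob_inner (0\<^sub>m m n) B = 0"
  unfolding frob_inner_def by simp
lemma frob_inner_zero_right: "dim_row A = m \<Longrightarrow> dim_col A = n \<Longrightarrow> frob_inner A (0\<^sub>m m n) = 0"
  unfolding frob_inner_def by simp
lemma frob_inner_transpose: "dim_row A = dim_row B \<Longrightarrow> dim_col A = dim_col B \<Longrightarrow> frob_inner (A\<^sup>T) (B\<^sup>T) = frob_inner A B"
  unfolding frob_inner_def by (simp, subst sum.swap, simp)

lemmas frob_inner_linear = frob_inner_add_left frob_inner_add_right frob_inner_minus_left
  frob_inner_minus_right frob_inner_smult_left frob_inner_smult_right
  frob_inner_zero_left frob_inner_zero_right

lemma frob_inner_mult_left: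
  assumes "dim_col A = dim_row B" "dim_row C = dim_row A" "dim_col C = dim_col B"
  shows "frob_inner (A * B) C = frob_inner B (A\<^sup>T * C)"
proof -
  have "frob_inner (A * B) C = (\<Sum>i<dim_row A. \<Sum>j<dim_col B. \<Sum>k<dim_row B. A $$ (i, k) * B $$ (k, j) * C $$ (i, j))"
    unfolding frob_inner_def using assms
    by (simp add: scalar_prod_def sum_distrib_right lessThan_atLeast0)
  also have "\<dots> = (\<Sum>j<dim_col B. \<Sum>k<dim_row B. \<Sum>i<dim_row A. A $$ (i, k) * B $$ (k, j) * C $$ (i, j))"
    by (subst sum.swap, rule sum.cong[OF refl], rule sum.swap)
  also have "\<dots> = (\<Sum>k<dim_row B. \<Sum>j<dim_col B. \<Sum>i<dim_row A. A $$ (i, k) * B $$ (k, j) * C $$ (i, j))"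
    by (rule sum.swap)
  also have "\<dots> = frob_inner B (A\<^sup>T * C)"
    unfolding frob_inner_def using assms
    by (simp add: scalar_prod_def sum_distrib_left lessThan_atLeast0 mult_ac)
  finally show ?thesis .
qed

lemma frob_inner_mult_right:
  assumes "dim_col A = dim_row B" "dim_row C = dim_row A" "dim_col C = dim_col B"
  shows "frob_inner (A * B) C = frob_inner A (C * B\<^sup>T)"
proof -
  have "frob_inner (A * B) C = frob_inner (B\<^sup>T * A\<^sup>T) (C\<^sup>T)"
    using assms by (simp add: frob_inner_transpose transpose_mult_dim flip: transpose_mult_dim)
  also have "\<dots> = frob_inner (A\<^sup>T) ((C * B\<^sup>T)\<^sup>T)"
    using assms by (subst frob_inner_mult_left) (simp_all add: transpose_mult_dim)
  also have "\<dots> = frob_inner A (C * B\<^sup>T)"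
    using assms by (simp add: frob_inner_transpose)
  finally show ?thesis .
qed

lemma frob_inner_rank_one:
  assumes "dim_row u = dim_row u'" "dim_row v = dim_row v'" "dim_col u = 1" "dim_col u' = 1" "dim_col v = 1" "dim_col v' = 1"
  shows "frob_inner (u * v\<^sup>T) (u' * v'\<^sup>T) = frob_inner u u' * frob_inner v v'"
  using assms unfolding frob_inner_def
  by (simp add: scalar_prod_def sum_product mult_ac)

lemma column_contract:
  assumes "dim_row q = dim_row q'" "dim_col q = 1" "dim_col q' = 1"
  shows "q\<^sup>T * q' = frob_inner q q' \<cdot>\<^sub>m 1\<^sub>m 1"
  using assms by (intro eq_matI) (auto simp: frob_inner_def scalar_prod_def lessThan_atLeast0)

lemma eq_zero_if_kills_columns:
  assumes "\<And>s. s \<in> carrier_mat (dim_col K) 1 \<Longrightarrow> K * s = 0\<^sub>m (dim_row K) 1"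
  shows "K = (0\<^sub>m (dim_row K) (dim_col K) :: real mat)"
proof (rule eq_matI)
  fix i j assume ij: "i < dim_row (0\<^sub>m (dim_row K) (dim_col K) :: real mat)" "j < dim_col (0\<^sub>m (dim_row K) (dim_col K) :: real mat)"
  let ?e = "mat (dim_col K) 1 (\<lambda>(a, b). if a = j then 1 else 0 :: real)"
  have "(K * ?e) $$ (i, 0) = K $$ (i, j)"
    using ij by (simp add: scalar_prod_def lessThan_atLeast0 if_distrib cong: if_cong)
  then show "K $$ (i, j) = 0\<^sub>m (dim_row K) (dim_col K) $$ (i, j)"
    using assms[of ?e] ij by simp
qed auto

definition column :: "real mat \<Rightarrow> nat \<Rightarrow> real mat" where
  "column U j = mat (dim_row U) 1 (\<lambda>(i, _). U $$ (i, j))"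

lemma dim_column [simp]: "dim_row (column U j) = dim_row U" "dim_col (column U j) = 1"
  by (simp_all add: column_def)

lemma frob_inner_columns: "frob_inner U U = (\<Sum>j<dim_col U. frob_inner (column U j) (column U j))"
  unfolding frob_inner_def column_def by (simp, subst sum.swap, simp)

lemma column_mult:
  assumes "dim_col M = dim_row U" "j < dim_col U"
  shows "column (M * U) j = M * column U j"
  using assms by (intro eq_matI) (auto simp: column_def scalar_prod_def)

text \<open>
  A product is the sum of the outer products of columns and rows. This passes from rank-one
  estimates to estimates for arbitrary matrices.
\<close>

lemma frob_inner_outer_columns:
  assumes "dim_row V = dim_col U" "dim_row G = dim_row U" "dim_col G = dim_col V"
  shows "frob_inner G (U * V) = (\<Sum>j<dim_col U. frob_inner G (column U j * (column (V\<^sup>T) j)\<^sup>T))"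
proof -
  have "frob_inner G (U * V) = (\<Sum>i<dim_row G. \<Sum>k<dim_col G. \<Sum>j<dim_col U. G $$ (i, k) * (U $$ (i, j) * V $$ (j, k)))"
    using assms unfolding frob_inner_def by (simp add: scalar_prod_def sum_distrib_left lessThan_atLeast0)
  also have "\<dots> = (\<Sum>i<dim_row G. \<Sum>j<dim_col U. \<Sum>k<dim_col G. G $$ (i, k) * (U $$ (i, j) * V $$ (j, k)))"
    by (rule sum.cong[OF refl], rule sum.swap)
  also have "\<dots> = (\<Sum>j<dim_col U. \<Sum>i<dim_row G. \<Sum>k<dim_col G. G $$ (i, k) * (U $$ (i, j) * V $$ (j, k)))"
    by (rule sum.swap)
  also have "\<dots> = (\<Sum>j<dim_col U. frob_inner G (column U j * (column (V\<^sup>T) j)\<^sup>T))"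
    using assms unfolding frob_inner_def by (simp add: scalar_prod_def column_def)
  finally show ?thesis .
qed

section \<open>One-sided inverses, kernels and projections\<close>

definition has_kernel :: "real mat \<Rightarrow> bool" where
  "has_kernel K \<longleftrightarrow> (\<exists>b\<in>carrier_mat (dim_col K) 1. b \<noteq> 0\<^sub>m (dim_col K) 1 \<and> K * b = 0\<^sub>m (dim_row K) 1)"

definition has_left_inverse :: "real mat \<Rightarrow> bool" where
  "has_left_inverse K \<longleftrightarrow> (\<exists>L\<in>carrier_mat (dim_col K) (dim_row K). L * K = 1\<^sub>m (dim_col K))"

lemma det_zero_imp_has_kernel:
  assumes "M \<in> carrier_mat n n" "det M = 0"
  shows "has_kernel M"
proof -
  obtain v where v: "v \<in> carrier_vec n" "v \<noteq> 0\<^sub>v n" "M *\<^sub>v v = 0\<^sub>v n"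
    using assms det_0_iff_vec_prod_zero_field by blast
  let ?b = "mat n 1 (\<lambda>(i, _). v $ i)"
  have "?b \<noteq> 0\<^sub>m n 1"
  proof
    assume b: "?b = 0\<^sub>m n 1"
    have "v = 0\<^sub>v n"
    proof (rule eq_vecI)
      fix i assume "i < dim_vec (0\<^sub>v n :: real vec)"
      then show "v $ i = 0\<^sub>v n $ i"
        using arg_cong[OF b, of "\<lambda>m. m $$ (i, 0)"] by simp
    qed (use v in auto)
    with v show False by simp
  qed
  moreover have "M * ?b = 0\<^sub>m n 1"
  proof (rule eq_matI)
    fix i j assume ij: "i < dim_row (0\<^sub>m n 1 :: real mat)" "j < dim_col (0\<^sub>m n 1 :: real mat)"
    have "col ?b 0 = v" using v by (intro eq_vecI) auto
    moreover have "row M i \<bullet> v = 0" using arg_cong[OF v(3), of "\<lambda>w. w $ i"] ij assms by simp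
    ultimately show "(M * ?b) $$ (i, j) = 0\<^sub>m n 1 $$ (i, j)"
      using ij assms v by simp
  qed (use assms in auto)
  ultimately show ?thesis
    unfolding has_kernel_def using assms by (intro bexI[of _ ?b]) auto
qed

text \<open>
  Padding with zero rows gives a square matrix with determinant zero.
\<close>

lemma wide_has_kernel:
  assumes "dim_row K < dim_col K"
  shows "has_kernel K"
proof -
  let ?n = "dim_col K"
  let ?M = "mat ?n ?n (\<lambda>(i, j). if i < dim_row K then K $$ (i, j) else 0)"
  have M: "?M \<in> carrier_mat ?n ?n" by simp
  let ?e = "unit_vec ?n (?n - 1) :: real vec"
  have "?M\<^sup>T *\<^sub>v ?e = 0\<^sub>v ?n"
  proof (rule eq_vecI)
    fix i assume i: "i < dim_vec (0\<^sub>v ?n :: real vec)"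
    then have "(?M\<^sup>T *\<^sub>v ?e) $ i = col ?M i $ (?n - 1)"
      using assms by (simp add: scalar_prod_right_unit)
    then show "(?M\<^sup>T *\<^sub>v ?e) $ i = 0\<^sub>v ?n $ i" using i assms by simp
  qed simp
  moreover have "?e \<noteq> 0\<^sub>v ?n" "?e \<in> carrier_vec ?n"
    using assms by (simp_all add: unit_vec_nonzero)
  ultimately have "det (?M\<^sup>T) = 0"
    using det_0_iff_vec_prod_zero_field[of "?M\<^sup>T" ?n] M transpose_carrier_mat by blast
  then have "det ?M = 0" using det_transpose[OF M] by simp
  then obtain b where b: "b \<in> carrier_mat ?n 1" "b \<noteq> 0\<^sub>m ?n 1" "?M * b = 0\<^sub>m ?n 1"
    using det_zero_imp_has_kernel[OF M] unfolding has_kernel_def by auto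
  have "K * b = 0\<^sub>m (dim_row K) 1"
  proof (rule eq_matI)
    fix i j assume ij: "i < dim_row (0\<^sub>m (dim_row K) 1 :: real mat)" "j < dim_col (0\<^sub>m (dim_row K) 1 :: real mat)"
    have "row ?M i = row K i" using ij assms by (intro eq_vecI) auto
    then show "(K * b) $$ (i, j) = 0\<^sub>m (dim_row K) 1 $$ (i, j)"
      using arg_cong[OF b(3), of "\<lambda>m. m $$ (i, 0)"] b(1) ij assms by simp
  qed (use b in auto)
  with b show ?thesis unfolding has_kernel_def by auto
qed

lemma det_nonzero_imp_left_inverse:
  assumes "M \<in> carrier_mat n n" "det M \<noteq> (0 :: real)"
  obtains L where "L \<in> carrier_mat n n" "L * M = 1\<^sub>m n" "M * L = 1\<^sub>m n"
  using det_non_zero_imp_unit[OF assms, unfolded Units_def ring_mat_def] by auto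

text \<open>
  The Gram matrix \<open>K\<^sup>T K\<close> has the same kernel as \<open>K\<close>. If it is invertible, \<open>L = (K\<^sup>T K)\<^sup>-\<^sup>1 K\<^sup>T\<close>
  is the left inverse for which \<open>K L\<close> is the orthogonal projection onto the range of \<open>K\<close>.
\<close>

lemma symmetric_left_inverse_or_kernel:
  obtains "has_kernel K"
  | L where "L \<in> carrier_mat (dim_col K) (dim_row K)" "L * K = 1\<^sub>m (dim_col K)" "(K * L)\<^sup>T = K * L"
proof -
  let ?n = "dim_col K" and ?m = "dim_row K"
  let ?S = "K\<^sup>T * K"
  have S: "?S \<in> carrier_mat ?n ?n" by (intro carrier_matI) simp_all
  have St: "?S\<^sup>T = ?S" by (simp add: trans_dim)
  show ?thesis
  proof (cases "det ?S = 0")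
    case True
    then obtain b where b: "b \<in> carrier_mat ?n 1" "b \<noteq> 0\<^sub>m ?n 1" "?S * b = 0\<^sub>m ?n 1"
      using det_zero_imp_has_kernel[OF S] unfolding has_kernel_def by auto
    note [simp] = carrier_matD[OF b(1)]
    have "frob_inner (K * b) (K * b) = frob_inner b (?S * b)"
      by (simp add: frob_inner_mult_left mat_dim)
    then have "frob_inner (K * b) (K * b) = 0" using b by (simp add: frob_inner_zero_right)
    then have "K * b = 0\<^sub>m ?m 1" using frob_inner_eq_0[of "K * b"] by simp
    with b have "has_kernel K" unfolding has_kernel_def by auto
    then show ?thesis by (rule that(1))
  next
    case False
    then obtain L where L: "L \<in> carrier_mat ?n ?n" "L * ?S = 1\<^sub>m ?n" "?S * L = 1\<^sub>m ?n"
      using det_nonzero_imp_left_inverse[OF S] by blast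
    note [simp] = carrier_matD[OF L(1)]
    have LtS: "L\<^sup>T * ?S = 1\<^sub>m ?n"
      using arg_cong[OF L(3), of transpose_mat] by (simp add: transpose_mult_dim[of ?S] St)
    have "L\<^sup>T = L\<^sup>T * (?S * L)" using L by simp
    also have "\<dots> = (L\<^sup>T * ?S) * L" by (simp add: mult_assoc_dim)
    also have "\<dots> = L" using LtS by simp
    finally have Lt: "L\<^sup>T = L" .
    show ?thesis
    proof (rule that(2)[of "L * K\<^sup>T"])
      show "L * K\<^sup>T * K = 1\<^sub>m ?n" using L(2) by (simp add: mult_assoc_dim)
      show "(K * (L * K\<^sup>T))\<^sup>T = K * (L * K\<^sup>T)" by (simp add: trans_dim Lt mat_dim)
    qed (intro carrier_matI, simp_all)
  qed
qed

lemma left_inverse_or_kernel: "has_left_inverse K \<or> has_kernel K"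
  using symmetric_left_inverse_or_kernel[of K] unfolding has_left_inverse_def by metis

lemma left_inverse_no_kernel:
  assumes "has_left_inverse K" shows "\<not> has_kernel K"
proof
  assume "has_kernel K"
  then obtain b where b: "b \<in> carrier_mat (dim_col K) 1" "b \<noteq> 0\<^sub>m (dim_col K) 1" "K * b = 0\<^sub>m (dim_row K) 1"
    unfolding has_kernel_def by auto
  obtain L where L: "L \<in> carrier_mat (dim_col K) (dim_row K)" "L * K = 1\<^sub>m (dim_col K)"
    using assms unfolding has_left_inverse_def by auto
  note [simp] = carrier_matD[OF L(1)] carrier_matD[OF b(1)]
  have "b = (L * K) * b" by (simp add: L mat_dim)
  also have "\<dots> = L * (K * b)" by (simp add: mult_assoc_dim)
  also have "\<dots> = 0\<^sub>m (dim_col K) 1" by (simp add: b mat_dim)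
  finally show False using b by simp
qed

lemma has_kernel_mult:
  assumes "dim_col A = dim_row B" "has_kernel B" shows "has_kernel (A * B)"
  using assms unfolding has_kernel_def
  by (metis carrier_matD index_mult_mat(2,3) mult_assoc_dim mult_zero_dim)

text \<open>
  A right inverse is expressed as a left inverse of the transpose. For a wide matrix a kernel always
  exists; in the square case injectivity and surjectivity coincide.
\<close>

lemma kernel_or_right_inverse:
  assumes "dim_row K \<le> dim_col K"
  shows "has_kernel K \<or> has_left_inverse (K\<^sup>T)"
proof (cases "dim_row K < dim_col K")
  case True
  then show ?thesis using wide_has_kernel by blast
next
  case False
  then have sq: "K \<in> carrier_mat (dim_col K) (dim_col K)" using assms by auto
  show ?thesis
  proof (cases "det K = 0")
    case True
    then show ?thesis using det_zero_imp_has_kernel[OF sq] by blast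
  next
    case False
    then have "det (K\<^sup>T) \<noteq> 0" using det_transpose[OF sq] by simp
    then show ?thesis
      using det_nonzero_imp_left_inverse[of "K\<^sup>T" "dim_col K"] sq unfolding has_left_inverse_def
      by (metis carrier_matD transpose_carrier_mat)
  qed
qed

text \<open>
  Left invertibility is generic: if \<open>L A = 1\<close> and \<open>A' + t A\<close> has a kernel, then \<open>- t\<close> is an
  eigenvalue of \<open>L A'\<close>, and there are only finitely many of these.
\<close>

lemma eventually_has_left_inverse:
  assumes "dim_row A' = dim_row A" "dim_col A' = dim_col A" "has_left_inverse A"
  shows "eventually (\<lambda>t. has_left_inverse (A' + t \<cdot>\<^sub>m A)) (at_right (0::real))"
proof -
  let ?n = "dim_col A"
  obtain L where L: "L \<in> carrier_mat ?n (dim_row A)" "L * A = 1\<^sub>m ?n"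
    using assms(3) unfolding has_left_inverse_def by auto
  note [simp] = carrier_matD[OF L(1)] assms(1,2)
  have M: "L * A' \<in> carrier_mat ?n ?n" by (intro carrier_matI) simp_all
  let ?roots = "{k. poly (char_poly (L * A')) k = 0}"
  have "char_poly (L * A') \<noteq> 0"
    using degree_monic_char_poly[OF M] by auto
  then have fin: "finite ?roots" by (rule poly_roots_finite)
  have good: "has_left_inverse (A' + t \<cdot>\<^sub>m A)" if "- t \<notin> ?roots" for t
  proof (rule ccontr)
    assume "\<not> has_left_inverse (A' + t \<cdot>\<^sub>m A)"
    then obtain b where b: "b \<in> carrier_mat ?n 1" "b \<noteq> 0\<^sub>m ?n 1" "(A' + t \<cdot>\<^sub>m A) * b = 0\<^sub>m (dim_row A) 1"
      using left_inverse_or_kernel[of "A' + t \<cdot>\<^sub>m A"] unfolding has_kernel_def by auto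
    note [simp] = carrier_matD[OF b(1)]
    have "L * ((A' + t \<cdot>\<^sub>m A) * b) = L * (A' * b) + t \<cdot>\<^sub>m ((L * A) * b)"
      by (simp add: mat_dim del: L)
    then have sum: "L * A' * b + t \<cdot>\<^sub>m b = 0\<^sub>m ?n 1"
      by (simp add: b(3) L(2) mat_dim)
    have ev: "(L * A' * b) $$ (i, 0) = - t * b $$ (i, 0)" if "i < ?n" for i
      using arg_cong[OF sum, of "\<lambda>m. m $$ (i, 0)"] that by (simp del: index_mult_mat(1))
    have "eigenvector (L * A') (col b 0) (- t)"
      unfolding eigenvector_def
    proof (intro conjI)
      show "col b 0 \<in> carrier_vec (dim_row (L * A'))" by (intro carrier_vecI) simp
      show "col b 0 \<noteq> 0\<^sub>v (dim_row (L * A'))"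
      proof
        assume z: "col b 0 = 0\<^sub>v (dim_row (L * A'))"
        have "b = 0\<^sub>m ?n 1"
        proof (rule eq_matI)
          fix i j assume "i < dim_row (0\<^sub>m ?n 1 :: real mat)" "j < dim_col (0\<^sub>m ?n 1 :: real mat)"
          then show "b $$ (i, j) = 0\<^sub>m ?n 1 $$ (i, j)"
            using arg_cong[OF z, of "\<lambda>v. v $ i"] by simp
        qed simp_all
        with b(2) show False ..
      qed
      show "(L * A') *\<^sub>v col b 0 = - t \<cdot>\<^sub>v col b 0"
      proof (rule eq_vecI)
        fix i assume "i < dim_vec (- t \<cdot>\<^sub>v col b 0)"
        then show "((L * A') *\<^sub>v col b 0) $ i = (- t \<cdot>\<^sub>v col b 0) $ i"
          using ev[of i] by simp
      qed simp
    qed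
    then have "eigenvalue (L * A') (- t)" unfolding eigenvalue_def by blast
    with eigenvalue_root_char_poly[OF M] that show False by simp
  qed
  have "eventually (\<lambda>t. t \<notin> uminus ` ?roots) (at_right 0)"
  proof -
    have "closed (uminus ` ?roots - {0})" using fin by (intro finite_imp_closed) auto
    then have "open (- (uminus ` ?roots - {0}))" by (simp add: closed_def)
    then have "eventually (\<lambda>t. t \<in> - (uminus ` ?roots - {0})) (at_right 0)"
      using eventually_at_topological by blast
    moreover have "eventually (\<lambda>t. (0::real) < t) (at_right 0)"
      by (simp add: eventually_at_right_less)
    ultimately show ?thesis by eventually_elim auto
  qed
  then show ?thesis
    by (rule eventually_mono) (use good in \<open>force\<close>)
qed

text \<open>
  The squared Frobenius norm of an orthogonal projection is its trace, hence its rank.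
\<close>

lemma frob_inner_projection:
  assumes "dim_row L = dim_col A" "dim_col L = dim_row A" "L * A = 1\<^sub>m (dim_col A)" "(A * L)\<^sup>T = A * L"
  shows "frob_inner (A * L) (A * L) = dim_col A"
proof -
  note [simp] = assms(1,2)
  have "A\<^sup>T * (A * L) = (A * L * A)\<^sup>T" by (simp add: transpose_mult_dim[of "A * L"] assms(4))
  also have "\<dots> = A\<^sup>T" by (simp add: mult_assoc_dim assms(3))
  finally have *: "A\<^sup>T * (A * L) = A\<^sup>T" .
  have "frob_inner (A * L) (A * L) = frob_inner L (A\<^sup>T)" by (simp add: frob_inner_mult_left *)
  also have "\<dots> = frob_inner (1\<^sub>m (dim_col A) * L) (A\<^sup>T)" by simp
  also have "\<dots> = frob_inner (1\<^sub>m (dim_col A)) ((L * A)\<^sup>T)" by (subst frob_inner_mult_right) (simp_all add: trans_dim)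
  also have "\<dots> = dim_col A" by (simp add: assms(3) frob_inner_def if_distrib cong: if_cong)
  finally show ?thesis .
qed

section \<open>Three facts about real inequalities\<close>

text \<open>
  Along a line in a pair of factors, a quadratic loss is a polynomial of degree four. The two claims
  are its first and second order conditions.
\<close>

lemma quartic_minimum_at_0:
  fixes c1 c2 c3 c4 :: real
  assumes "\<epsilon> > 0" and nonneg: "\<And>t. \<bar>t\<bar> < \<epsilon> \<Longrightarrow> 0 \<le> c1 * t + c2 * t ^ 2 + c3 * t ^ 3 + c4 * t ^ 4"
  shows "c1 = 0" and "0 \<le> c2"
proof -
  let ?f = "\<lambda>t. c1 * t + c2 * t ^ 2 + c3 * t ^ 3 + c4 * t ^ 4"
  have "(?f has_field_derivative c1) (at 0)"
    by (auto intro!: derivative_eq_intros)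
  then show c1: "c1 = 0"
    by (rule DERIV_local_min[OF _ \<open>\<epsilon> > 0\<close>]) (use nonneg in auto)
  have "((\<lambda>t. c2 + c3 * t + c4 * t ^ 2) \<longlongrightarrow> c2 + c3 * 0 + c4 * 0 ^ 2) (at_right 0)"
    by (intro tendsto_intros)
  moreover have "eventually (\<lambda>t. 0 \<le> c2 + c3 * t + c4 * t ^ 2) (at_right 0)"
    unfolding eventually_at_right_field
  proof (intro exI[of _ \<epsilon>] conjI allI impI)
    fix t assume t: "0 < t" "t < \<epsilon>"
    then have "0 \<le> t ^ 2 * (c2 + c3 * t + c4 * t ^ 2)"
      using nonneg[of t] c1 by (simp add: algebra_simps power2_eq_square power3_eq_cube power4_eq_xxxx)
    then show "0 \<le> c2 + c3 * t + c4 * t ^ 2"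
      using t by (simp add: zero_le_mult_iff)
  qed (fact assms)
  ultimately show "0 \<le> c2"
    using tendsto_lowerbound[of _ _ "at_right (0::real)" 0] by force
qed

text \<open>
  A positive semidefinite binary quadratic form has non-positive discriminant.
\<close>

lemma discriminant_bound:
  fixes k a c :: real
  assumes "0 \<le> a" "0 \<le> c" and psd: "\<And>s z. 0 \<le> s * z * k + 1 / 2 * (s ^ 2 * a + z ^ 2 * c)"
  shows "k ^ 2 \<le> a * c"
proof -
  have "0 \<le> a * (a * c - k ^ 2)" "0 \<le> c * (a * c - k ^ 2)"
    using psd[of "- k" a] psd[of c "- k"] by (simp_all add: algebra_simps power2_eq_square)
  moreover have "a = 0 \<Longrightarrow> c = 0 \<Longrightarrow> k ^ 2 \<le> 0"
    using psd[of 1 "- k"] by (simp add: power2_eq_square)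
  ultimately show ?thesis
    using assms(1,2) by (cases "a = 0"; cases "c = 0") (auto simp: zero_le_mult_iff mult_le_0_iff)
qed

text \<open>
  The infimum of the quotients \<open>c / d\<close> separates them from the quotients \<open>k / b\<close>. Products in place
  of quotients allow \<open>b\<close> and \<open>d\<close> to vanish.
\<close>

lemma separating_ratio:
  fixes S :: "(real \<times> real) set" and T :: "(real \<times> real) set"
  assumes S: "\<And>k b d c. (k, b) \<in> S \<Longrightarrow> (d, c) \<in> T \<Longrightarrow> k * d \<le> b * c"
    and pos: "\<And>d c. (d, c) \<in> T \<Longrightarrow> 0 \<le> d \<and> 0 \<le> c" and ex: "(d0, c0) \<in> T" "0 < d0"
  obtains \<tau> where "0 \<le> \<tau>" "\<And>k b. (k, b) \<in> S \<Longrightarrow> 0 \<le> b \<Longrightarrow> k \<le> \<tau> * b" "\<And>d c. (d, c) \<in> T \<Longrightarrow> \<tau> * d \<le> c"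
proof -
  define Q where "Q = {c / d | d c. (d, c) \<in> T \<and> 0 < d}"
  have ne: "Q \<noteq> {}" using ex unfolding Q_def by blast
  have bdd: "bdd_below Q"
    using pos unfolding Q_def by (intro bdd_belowI[of _ 0]) auto
  show thesis
  proof (rule that[of "Inf Q"])
    show "0 \<le> Inf Q"
      using pos by (intro cInf_greatest[OF ne]) (auto simp: Q_def)
    show "Inf Q * d \<le> c" if "(d, c) \<in> T" for d c
    proof (cases "d = 0")
      case False
      then have d: "0 < d" using pos[OF that] by auto
      then have "Inf Q \<le> c / d"
        using that by (intro cInf_lower[OF _ bdd]) (auto simp: Q_def)
      then show ?thesis using d by (simp add: pos_le_divide_eq)
    qed (use pos[OF that] in auto)
    show "k \<le> Inf Q * b" if kb: "(k, b) \<in> S" "0 \<le> b" for k b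
    proof (cases "b = 0")
      case True
      then have "k * d0 \<le> 0" using S[OF kb(1) ex(1)] by simp
      then show ?thesis using True ex(2) by (simp add: mult_le_0_iff)
    next
      case False
      then have b: "0 < b" using kb(2) by simp
      have "k / b \<le> Inf Q"
      proof (rule cInf_greatest[OF ne])
        fix x assume "x \<in> Q"
        then obtain d c where dc: "(d, c) \<in> T" "0 < d" "x = c / d" unfolding Q_def by auto
        then have "k * d \<le> c * b" using S[OF kb(1) dc(1)] by (simp add: mult.commute)
        then show "k / b \<le> x" using b dc by (simp add: divide_le_eq le_divide_eq)
      qed
      then show ?thesis using b by (simp add: pos_divide_le_eq)
    qed
  qed
qed

section \<open>Two-layer linear networks with a left-invertible outer factor\<close>

definition loss :: "real mat \<Rightarrow> real mat \<Rightarrow> real mat \<Rightarrow> real" where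
  "loss X Y M = 1 / 2 * frob_inner (M * X - Y) (M * X - Y)"

text \<open>
  The expansion is exact because the loss is quadratic in \<open>M\<close>. Its last term is non-negative, which
  makes every \<open>M\<close> with vanishing gradient \<open>(M X - Y) X\<^sup>T\<close> a global minimum.
\<close>

lemma loss_expand:
  assumes "dim_col M = dim_row X" "dim_row Y = dim_row M" "dim_col Y = dim_col X"
    "dim_row E = dim_row M" "dim_col E = dim_col M"
  shows "loss X Y (M + E) = loss X Y M + frob_inner ((M * X - Y) * X\<^sup>T) E + 1 / 2 * frob_inner (E * X) (E * X)"
proof -
  have split: "(M + E) * X - Y = (M * X - Y) + E * X"
    using assms by (intro eq_matI) (auto simp: add_mult_distrib_dim)
  have "frob_inner (E * X) (M * X - Y) = frob_inner E ((M * X - Y) * X\<^sup>T)"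
    using assms by (intro frob_inner_mult_right) auto
  also have "\<dots> = frob_inner ((M * X - Y) * X\<^sup>T) E"
    using assms by (intro frob_inner_commute) auto
  finally have cross: "frob_inner (E * X) (M * X - Y) = frob_inner ((M * X - Y) * X\<^sup>T) E" .
  have "frob_inner (E * X) (M * X - Y) = frob_inner (M * X - Y) (E * X)"
    using assms by (intro frob_inner_commute) auto
  with cross show ?thesis
    using assms unfolding loss_def split by (simp add: frob_inner_add_left frob_inner_add_right distrib_left)
qed

text \<open>
  A pair \<open>(A, B)\<close> that is a minimum along every line through it, which is all that a local minimum
  provides below. Taking for \<open>LA\<close> the left inverse that makes \<open>A LA\<close> symmetric fixes the orthogonal
  projection onto the range of \<open>A\<close>; it is called \<open>P\<close> below, and \<open>G\<close> is the gradient of the loss at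
  \<open>A B\<close>.
\<close>

locale two_layer_minimum =
  fixes A B X Y LA :: "real mat"
  assumes dims [simp]: "dim_row B = dim_col A" "dim_row X = dim_col B" "dim_row Y = dim_row A"
      "dim_col Y = dim_col X" "dim_row LA = dim_col A" "dim_col LA = dim_row A"
    and pos: "0 < dim_col A"
    and left_inv: "LA * A = 1\<^sub>m (dim_col A)" and proj_sym: "(A * LA)\<^sup>T = A * LA"
    and minimum: "\<And>dA dB. dA \<in> carrier_mat (dim_row A) (dim_col A) \<Longrightarrow> dB \<in> carrier_mat (dim_row B) (dim_col B) \<Longrightarrow>
      \<exists>\<epsilon>>0. \<forall>t. \<bar>t\<bar> < \<epsilon> \<longrightarrow> loss X Y (A * B) \<le> loss X Y ((A + t \<cdot>\<^sub>m dA) * (B + t \<cdot>\<^sub>m dB))"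
begin

definition "G = (A * B * X - Y) * X\<^sup>T"
definition "P = A * LA"

lemma dim_G [simp]: "dim_row G = dim_row A" "dim_col G = dim_col B"
  by (simp_all add: G_def)
lemma dim_P [simp]: "dim_row P = dim_row A" "dim_col P = dim_row A"
  by (simp_all add: P_def)

lemma P_sym: "P\<^sup>T = P" by (simp add: P_def proj_sym)
lemma P_A: "P * A = A" by (simp add: P_def mult_assoc_dim left_inv)
lemma P_idem: "P * P = P"
  using mult_assoc_dim[of P A LA] by (simp add: P_A flip: P_def)
lemma At_P: "A\<^sup>T * P = A\<^sup>T"
  using arg_cong[OF P_A, of transpose_mat] by (simp add: transpose_mult_dim P_sym)

text \<open>
  The first and second order conditions: \<open>dA B + A dB\<close> and \<open>dA dB\<close> are the coefficients of \<open>t\<close>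
  and \<open>t\<^sup>2\<close> in the perturbed product.
\<close>

lemma variations:
  assumes "dA \<in> carrier_mat (dim_row A) (dim_col A)" "dB \<in> carrier_mat (dim_row B) (dim_col B)"
  shows "frob_inner G (dA * B + A * dB) = 0"
    and "0 \<le> frob_inner G (dA * dB) + 1 / 2 * frob_inner ((dA * B + A * dB) * X) ((dA * B + A * dB) * X)"
proof -
  note [simp] = carrier_matD[OF assms(1)] carrier_matD[OF assms(2)]
  define E F where "E = dA * B + A * dB" and "F = dA * dB"
  have [simp]: "dim_row E = dim_row A" "dim_col E = dim_col B" "dim_row F = dim_row A" "dim_col F = dim_col B"
    by (simp_all add: E_def F_def)
  obtain \<epsilon> where \<epsilon>: "\<epsilon> > 0" "\<And>t. \<bar>t\<bar> < \<epsilon> \<Longrightarrow> loss X Y (A * B) \<le> loss X Y ((A + t \<cdot>\<^sub>m dA) * (B + t \<cdot>\<^sub>m dB))"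
    using minimum[OF assms] by auto
  have expand: "loss X Y ((A + t \<cdot>\<^sub>m dA) * (B + t \<cdot>\<^sub>m dB)) = loss X Y (A * B) + (frob_inner G E * t
     + (frob_inner G F + 1 / 2 * frob_inner (E * X) (E * X)) * t ^ 2 + frob_inner (E * X) (F * X) * t ^ 3
     + (1 / 2 * frob_inner (F * X) (F * X)) * t ^ 4)" for t
  proof -
    have "(A + t \<cdot>\<^sub>m dA) * (B + t \<cdot>\<^sub>m dB) = A * B + t \<cdot>\<^sub>m (dA * B) + t \<cdot>\<^sub>m (A * dB + t \<cdot>\<^sub>m (dA * dB))"
      by (simp add: mat_dim)
    also have "\<dots> = A * B + (t \<cdot>\<^sub>m E + t ^ 2 \<cdot>\<^sub>m F)"
      unfolding E_def F_def
      by (intro eq_matI) (simp_all add: distrib_left power2_eq_square del: index_mult_mat(1))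
    finally have "loss X Y ((A + t \<cdot>\<^sub>m dA) * (B + t \<cdot>\<^sub>m dB)) = loss X Y (A * B)
        + frob_inner G (t \<cdot>\<^sub>m E + t ^ 2 \<cdot>\<^sub>m F) + 1 / 2 * frob_inner ((t \<cdot>\<^sub>m E + t ^ 2 \<cdot>\<^sub>m F) * X) ((t \<cdot>\<^sub>m E + t ^ 2 \<cdot>\<^sub>m F) * X)"
      by (simp add: loss_expand G_def)
    moreover have "frob_inner G (t \<cdot>\<^sub>m E + t ^ 2 \<cdot>\<^sub>m F) = t * frob_inner G E + t ^ 2 * frob_inner G F"
      by (simp add: frob_inner_linear)
    moreover have "(t \<cdot>\<^sub>m E + t ^ 2 \<cdot>\<^sub>m F) * X = t \<cdot>\<^sub>m (E * X) + t ^ 2 \<cdot>\<^sub>m (F * X)"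
      by (simp add: add_mult_distrib_dim smult_mult_dim)
    moreover have "frob_inner (t \<cdot>\<^sub>m (E * X) + t ^ 2 \<cdot>\<^sub>m (F * X)) (t \<cdot>\<^sub>m (E * X) + t ^ 2 \<cdot>\<^sub>m (F * X))
        = t ^ 2 * frob_inner (E * X) (E * X) + 2 * t ^ 3 * frob_inner (E * X) (F * X) + t ^ 4 * frob_inner (F * X) (F * X)"
    proof -
      have "frob_inner (F * X) (E * X) = frob_inner (E * X) (F * X)" by (rule frob_inner_commute) simp_all
      then show ?thesis
        by (simp add: frob_inner_linear) (simp add: distrib_left mult_ac power2_eq_square power3_eq_cube power4_eq_xxxx)
    qed
    ultimately show ?thesis by (simp add: distrib_left distrib_right mult_ac)
  qed
  have nonneg: "0 \<le> frob_inner G E * t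
     + (frob_inner G F + 1 / 2 * frob_inner (E * X) (E * X)) * t ^ 2 + frob_inner (E * X) (F * X) * t ^ 3
     + (1 / 2 * frob_inner (F * X) (F * X)) * t ^ 4" if "\<bar>t\<bar> < \<epsilon>" for t
    using \<epsilon>(2)[OF that] unfolding expand by linarith
  have "frob_inner G E = 0" "0 \<le> frob_inner G F + 1 / 2 * frob_inner (E * X) (E * X)"
    using quartic_minimum_at_0[OF \<epsilon>(1) nonneg] by blast+
  then show "frob_inner G (dA * B + A * dB) = 0"
    "0 \<le> frob_inner G (dA * dB) + 1 / 2 * frob_inner ((dA * B + A * dB) * X) ((dA * B + A * dB) * X)"
    by (simp_all add: E_def F_def)
qed

lemma G_Bt: "G * B\<^sup>T = 0\<^sub>m (dim_row A) (dim_col A)"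
proof -
  have "frob_inner G (G * B\<^sup>T * B + A * 0\<^sub>m (dim_row B) (dim_col B)) = 0"
    by (rule variations) (auto intro!: carrier_matI)
  then have "frob_inner (G * B\<^sup>T * B) G = 0"
    by (simp add: mult_zero_dim add_zero_dim frob_inner_commute[of G])
  then have "frob_inner (G * B\<^sup>T) (G * B\<^sup>T) = 0" by (simp add: frob_inner_mult_right)
  then show ?thesis using frob_inner_eq_0[of "G * B\<^sup>T"] by simp
qed

lemma At_G: "A\<^sup>T * G = 0\<^sub>m (dim_col A) (dim_col B)"
proof -
  have "frob_inner G (0\<^sub>m (dim_row A) (dim_col A) * B + A * (A\<^sup>T * G)) = 0"
    by (rule variations) (auto intro!: carrier_matI)
  then have "frob_inner (A * (A\<^sup>T * G)) G = 0"
    by (simp add: zero_mult_dim zero_add_dim frob_inner_commute[of G])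
  then have "frob_inner (A\<^sup>T * G) (A\<^sup>T * G) = 0" by (simp add: frob_inner_mult_left)
  then show ?thesis using frob_inner_eq_0[of "A\<^sup>T * G"] by simp
qed

text \<open>
  Vary by \<open>dA = s u q\<^sup>T\<close> and \<open>dB = z q' v\<^sup>T\<close>. Since \<open>u\<close> is orthogonal to the range of \<open>A\<close>, the
  second order condition is a binary quadratic form in \<open>(s, z)\<close>: its mixed coefficient comes from
  the gradient alone, its diagonal coefficients from the quadratic part of the loss. The
  claim is its discriminant inequality.
\<close>

lemma rank_one_curvature:
  assumes [simp]: "dim_row u = dim_row A" "dim_col u = 1" "dim_row v = dim_col B" "dim_col v = 1"
      "dim_row q = dim_col A" "dim_col q = 1" "dim_row q' = dim_col A" "dim_col q' = 1"
    and orth: "A\<^sup>T * u = 0\<^sub>m (dim_col A) 1"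
  shows "(frob_inner q q' * frob_inner G (u * v\<^sup>T))\<^sup>2
    \<le> (frob_inner u u * frob_inner ((B * X)\<^sup>T * q) ((B * X)\<^sup>T * q)) * (frob_inner (A * q') (A * q') * frob_inner (X\<^sup>T * v) (X\<^sup>T * v))"
proof (rule discriminant_bound)
  let ?p = "(B * X)\<^sup>T * q" and ?a = "A * q'" and ?x = "X\<^sup>T * v"
  fix s z :: real
  let ?dA = "s \<cdot>\<^sub>m (u * q\<^sup>T)" and ?dB = "z \<cdot>\<^sub>m (q' * v\<^sup>T)"
  have F: "?dA * ?dB = (s * z * frob_inner q q') \<cdot>\<^sub>m (u * v\<^sup>T)"
  proof -
    have "u * q\<^sup>T * (q' * v\<^sup>T) = u * ((q\<^sup>T * q') * v\<^sup>T)" by (simp add: mult_assoc_dim)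
    also have "\<dots> = frob_inner q q' \<cdot>\<^sub>m (u * v\<^sup>T)"
      by (simp add: column_contract mat_dim)
    finally show ?thesis by (simp add: mat_dim smult_smult mult_ac)
  qed
  have EX: "(?dA * B + A * ?dB) * X = s \<cdot>\<^sub>m (u * ?p\<^sup>T) + z \<cdot>\<^sub>m (?a * ?x\<^sup>T)"
    by (simp add: mat_dim trans_dim)
  have "frob_inner u ?a = frob_inner ?a u" by (rule frob_inner_commute) simp_all
  also have "\<dots> = 0" by (simp add: frob_inner_mult_left orth frob_inner_zero_right)
  finally have ua: "frob_inner u ?a = 0" "frob_inner ?a u = 0" using frob_inner_commute[of u ?a] by simp_all
  have "frob_inner ((?dA * B + A * ?dB) * X) ((?dA * B + A * ?dB) * X)
      = s ^ 2 * (frob_inner u u * frob_inner ?p ?p) + z ^ 2 * (frob_inner ?a ?a * frob_inner ?x ?x)"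
    unfolding EX by (simp add: frob_inner_linear frob_inner_rank_one ua power2_eq_square del: transpose_mult)
  moreover have "0 \<le> frob_inner G (?dA * ?dB) + 1 / 2 * frob_inner ((?dA * B + A * ?dB) * X) ((?dA * B + A * ?dB) * X)"
    by (rule variations) (auto intro!: carrier_matI)
  ultimately show "0 \<le> s * z * (frob_inner q q' * frob_inner G (u * v\<^sup>T))
      + 1 / 2 * (s ^ 2 * (frob_inner u u * frob_inner ?p ?p) + z ^ 2 * (frob_inner ?a ?a * frob_inner ?x ?x))"
    by (simp add: F frob_inner_smult_right mult.assoc)
qed simp_all

lemma frob_inner_P: "dim_row w = dim_row A \<Longrightarrow> frob_inner w (P * w) = frob_inner (P * w) (P * w)"
proof -
  assume w [simp]: "dim_row w = dim_row A"
  have "frob_inner (P * w) (P * w) = frob_inner w (P * (P * w))" by (simp add: frob_inner_mult_left P_sym)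
  also have "P * (P * w) = P * w" by (simp add: P_idem flip: mult_assoc_dim)
  finally show ?thesis by simp
qed

text \<open>
  For \<open>q = A\<^sup>T w\<close> and \<open>q' = LA w\<close> one has \<open>q\<^sup>T q' = \<parallel>P w\<parallel>\<^sup>2\<close> and \<open>A q' = P w\<close>, so one factor
  \<open>\<parallel>P w\<parallel>\<^sup>2\<close> cancels. Read as quotients, the left one bounds the singular values of the residual
  orthogonal to \<open>A\<close> (restricted to the row space of \<open>X\<close>), the right one the singular values of
  \<open>A B X\<close> on the range of \<open>A\<close>.
\<close>

lemma gradient_singular_value_bound:
  assumes [simp]: "dim_row u = dim_row A" "dim_col u = 1" "dim_row v = dim_col B" "dim_col v = 1"
      "dim_row w = dim_row A" "dim_col w = 1"
    and orth: "A\<^sup>T * u = 0\<^sub>m (dim_col A) 1"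
  shows "(frob_inner G (u * v\<^sup>T))\<^sup>2 * frob_inner (P * w) (P * w)
    \<le> frob_inner u u * frob_inner (X\<^sup>T * v) (X\<^sup>T * v) * frob_inner ((A * B * X)\<^sup>T * w) ((A * B * X)\<^sup>T * w)"
proof -
  let ?d = "frob_inner (P * w) (P * w)" and ?k = "frob_inner G (u * v\<^sup>T)"
  have "frob_inner (A\<^sup>T * w) (LA * w) = frob_inner w (A * (LA * w))" by (simp add: frob_inner_mult_left)
  also have "A * (LA * w) = P * w" by (simp add: P_def mult_assoc_dim)
  finally have qq: "frob_inner (A\<^sup>T * w) (LA * w) = ?d" by (simp add: frob_inner_P)
  have "A * (LA * w) = P * w" "(B * X)\<^sup>T * (A\<^sup>T * w) = (A * B * X)\<^sup>T * w"
    by (simp_all add: P_def mat_dim trans_dim)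
  then have "(?d * ?k)\<^sup>2 \<le> (frob_inner u u * frob_inner ((A * B * X)\<^sup>T * w) ((A * B * X)\<^sup>T * w)) * (?d * frob_inner (X\<^sup>T * v) (X\<^sup>T * v))"
    using rank_one_curvature[of u v "A\<^sup>T * w" "LA * w"] orth by (simp add: qq)
  then have "?d * (?k\<^sup>2 * ?d) \<le> ?d * (frob_inner u u * frob_inner (X\<^sup>T * v) (X\<^sup>T * v) * frob_inner ((A * B * X)\<^sup>T * w) ((A * B * X)\<^sup>T * w))"
    by (simp add: power2_eq_square mult_ac)
  then show ?thesis
    by (cases "?d = 0") (auto simp: mult_le_cancel_left less_le)
qed

text \<open>
  The number \<open>\<tau>\<close> separates the squared singular values of the residual orthogonal to \<open>A\<close> from
  those of \<open>A B X\<close> on the range of \<open>A\<close>; it comes from the preceding inequality by taking an infimum.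
\<close>

lemma spectral_gap:
  obtains \<tau> where "0 \<le> \<tau>"
    and "\<And>u v. dim_row u = dim_row A \<Longrightarrow> dim_col u = 1 \<Longrightarrow> dim_row v = dim_col B \<Longrightarrow> dim_col v = 1 \<Longrightarrow>
        A\<^sup>T * u = 0\<^sub>m (dim_col A) 1 \<Longrightarrow> (frob_inner G (u * v\<^sup>T))\<^sup>2 \<le> \<tau> * (frob_inner u u * frob_inner (X\<^sup>T * v) (X\<^sup>T * v))"
    and "\<And>w. dim_row w = dim_row A \<Longrightarrow> dim_col w = 1 \<Longrightarrow>
        \<tau> * frob_inner (P * w) (P * w) \<le> frob_inner ((A * B * X)\<^sup>T * w) ((A * B * X)\<^sup>T * w)"
proof -
  define S where "S = {((frob_inner G (u * v\<^sup>T))\<^sup>2, frob_inner u u * frob_inner (X\<^sup>T * v) (X\<^sup>T * v)) | u v :: real mat.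
    dim_row u = dim_row A \<and> dim_col u = 1 \<and> dim_row v = dim_col B \<and> dim_col v = 1 \<and> A\<^sup>T * u = 0\<^sub>m (dim_col A) 1}"
  define T where "T = {(frob_inner (P * w) (P * w), frob_inner ((A * B * X)\<^sup>T * w) ((A * B * X)\<^sup>T * w)) | w.
    dim_row w = dim_row A \<and> dim_col w = 1}"
  \<comment> \<open>Any non-zero vector in the range of \<open>A\<close> shows that the infimum is over a non-empty set.\<close>
  let ?e = "mat (dim_col A) 1 (\<lambda>_. 1) :: real mat"
  let ?w = "A * ?e"
  have "frob_inner (P * ?w) (P * ?w) \<noteq> 0"
  proof
    have Pw: "P * ?w = A * ?e" by (simp add: P_A flip: mult_assoc_dim)
    assume "frob_inner (P * ?w) (P * ?w) = 0"
    then have "A * ?e = 0\<^sub>m (dim_row A) 1" using frob_inner_eq_0[of "A * ?e"] Pw by simp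
    then have "LA * A * ?e = 0\<^sub>m (dim_col A) 1" by (simp add: mat_dim)
    then have "?e = 0\<^sub>m (dim_col A) 1" by (simp add: left_inv)
    from arg_cong[OF this, of "\<lambda>m. m $$ (0, 0)"] show False using pos by simp
  qed
  then have "0 < frob_inner (P * ?w) (P * ?w)" by (simp add: less_le)
  moreover have "(frob_inner (P * ?w) (P * ?w), frob_inner ((A * B * X)\<^sup>T * ?w) ((A * B * X)\<^sup>T * ?w)) \<in> T"
    unfolding T_def by (intro CollectI exI[of _ ?w]) simp
  moreover have "k * d \<le> b * c" if "(k, b) \<in> S" "(d, c) \<in> T" for k b d c
    using that gradient_singular_value_bound unfolding S_def T_def by auto
  moreover have "0 \<le> d \<and> 0 \<le> c" if "(d, c) \<in> T" for d c
    using that unfolding T_def by auto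
  ultimately obtain \<tau> where \<tau>: "0 \<le> \<tau>" "\<And>k b. (k, b) \<in> S \<Longrightarrow> 0 \<le> b \<Longrightarrow> k \<le> \<tau> * b" "\<And>d c. (d, c) \<in> T \<Longrightarrow> \<tau> * d \<le> c"
    using separating_ratio[of S T] by metis
  show thesis
  proof (rule that[OF \<tau>(1)])
    fix u v :: "real mat" assume "dim_row u = dim_row A" "dim_col u = 1" "dim_row v = dim_col B" "dim_col v = 1"
      "A\<^sup>T * u = 0\<^sub>m (dim_col A) 1"
    then have "((frob_inner G (u * v\<^sup>T))\<^sup>2, frob_inner u u * frob_inner (X\<^sup>T * v) (X\<^sup>T * v)) \<in> S" unfolding S_def by blast
    then show "(frob_inner G (u * v\<^sup>T))\<^sup>2 \<le> \<tau> * (frob_inner u u * frob_inner (X\<^sup>T * v) (X\<^sup>T * v))"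
      by (rule \<tau>(2)) simp
  next
    fix w :: "real mat" assume "dim_row w = dim_row A" "dim_col w = 1"
    then have "(frob_inner (P * w) (P * w), frob_inner ((A * B * X)\<^sup>T * w) ((A * B * X)\<^sup>T * w)) \<in> T" unfolding T_def by blast
    then show "\<tau> * frob_inner (P * w) (P * w) \<le> frob_inner ((A * B * X)\<^sup>T * w) ((A * B * X)\<^sup>T * w)" by (rule \<tau>(3))
  qed
qed

text \<open>
  Summing the vector inequalities over columns. The first one uses the arithmetic-geometric mean
  inequality to replace the product of norms by a sum, which is what makes it additive.
\<close>

lemma spectral_gap_mat:
  obtains \<tau> where "0 \<le> \<tau>"
    and "\<And>U V. dim_row U = dim_row A \<Longrightarrow> dim_row V = dim_col U \<Longrightarrow> dim_col V = dim_col B \<Longrightarrow>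
        A\<^sup>T * U = 0\<^sub>m (dim_col A) (dim_col U) \<Longrightarrow>
        - (1 / 2) * (\<tau> * frob_inner U U + frob_inner (V * X) (V * X)) \<le> frob_inner G (U * V)"
    and "\<And>C. dim_row C = dim_row A \<Longrightarrow>
        \<tau> * frob_inner (P * C) (P * C) \<le> frob_inner ((A * B * X)\<^sup>T * C) ((A * B * X)\<^sup>T * C)"
proof -
  obtain \<tau> where \<tau>: "0 \<le> \<tau>"
    "\<And>u v. dim_row u = dim_row A \<Longrightarrow> dim_col u = 1 \<Longrightarrow> dim_row v = dim_col B \<Longrightarrow> dim_col v = 1 \<Longrightarrow>
        A\<^sup>T * u = 0\<^sub>m (dim_col A) 1 \<Longrightarrow> (frob_inner G (u * v\<^sup>T))\<^sup>2 \<le> \<tau> * (frob_inner u u * frob_inner (X\<^sup>T * v) (X\<^sup>T * v))"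
    "\<And>w. dim_row w = dim_row A \<Longrightarrow> dim_col w = 1 \<Longrightarrow>
        \<tau> * frob_inner (P * w) (P * w) \<le> frob_inner ((A * B * X)\<^sup>T * w) ((A * B * X)\<^sup>T * w)"
    using spectral_gap by blast
  show thesis
  proof (rule that[OF \<tau>(1)])
    fix U V :: "real mat"
    assume [simp]: "dim_row U = dim_row A" "dim_row V = dim_col U" "dim_col V = dim_col B"
      and AU: "A\<^sup>T * U = 0\<^sub>m (dim_col A) (dim_col U)"
    let ?u = "\<lambda>j. column U j" and ?v = "\<lambda>j. column (V\<^sup>T) j"
    have one: "- (1 / 2) * (\<tau> * frob_inner (?u j) (?u j) + frob_inner (X\<^sup>T * ?v j) (X\<^sup>T * ?v j)) \<le> frob_inner G (?u j * (?v j)\<^sup>T)"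
      if j: "j < dim_col U" for j
    proof -
      let ?a = "frob_inner (?u j) (?u j)" and ?b = "frob_inner (X\<^sup>T * ?v j) (X\<^sup>T * ?v j)" and ?k = "frob_inner G (?u j * (?v j)\<^sup>T)"
      have "A\<^sup>T * ?u j = column (A\<^sup>T * U) j" using j by (simp add: column_mult)
      also have "\<dots> = 0\<^sub>m (dim_col A) 1" unfolding AU using j by (intro eq_matI) (auto simp: column_def)
      finally have "?k\<^sup>2 \<le> \<tau> * (?a * ?b)" using \<tau>(2)[of "?u j" "?v j"] by simp
      also have "\<dots> \<le> (1 / 2 * (\<tau> * ?a + ?b))\<^sup>2"
        using zero_le_power2[of "\<tau> * ?a - ?b"] by (simp add: power2_eq_square algebra_simps)
      finally have "\<bar>?k\<bar> \<le> 1 / 2 * (\<tau> * ?a + ?b)"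
        using \<tau>(1) by (intro power2_le_imp_le[of "\<bar>?k\<bar>"]) auto
      then show ?thesis by linarith
    qed
    have "frob_inner (V * X) (V * X) = frob_inner (X\<^sup>T * V\<^sup>T) (X\<^sup>T * V\<^sup>T)"
      using frob_inner_transpose[of "V * X" "V * X"] by (simp add: trans_dim)
    also have "\<dots> = (\<Sum>j<dim_col U. frob_inner (X\<^sup>T * ?v j) (X\<^sup>T * ?v j))"
      by (subst frob_inner_columns) (simp add: column_mult)
    finally have "- (1 / 2) * (\<tau> * frob_inner U U + frob_inner (V * X) (V * X))
       = (\<Sum>j<dim_col U. - (1 / 2) * (\<tau> * frob_inner (?u j) (?u j) + frob_inner (X\<^sup>T * ?v j) (X\<^sup>T * ?v j)))"
      by (simp add: frob_inner_columns[of U] sum.distrib sum_distrib_left sum_negf sum_subtractf sum_divide_distrib add_divide_distrib)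
    also have "\<dots> \<le> (\<Sum>j<dim_col U. frob_inner G (?u j * (?v j)\<^sup>T))"
      by (rule sum_mono) (use one in auto)
    also have "\<dots> = frob_inner G (U * V)" by (rule frob_inner_outer_columns[symmetric]) simp_all
    finally show "- (1 / 2) * (\<tau> * frob_inner U U + frob_inner (V * X) (V * X)) \<le> frob_inner G (U * V)" .
  next
    fix C :: "real mat" assume [simp]: "dim_row C = dim_row A"
    have "\<tau> * frob_inner (P * C) (P * C) = (\<Sum>j<dim_col C. \<tau> * frob_inner (P * column C j) (P * column C j))"
      by (subst frob_inner_columns) (simp add: column_mult sum_distrib_left)
    also have "\<dots> \<le> (\<Sum>j<dim_col C. frob_inner ((A * B * X)\<^sup>T * column C j) ((A * B * X)\<^sup>T * column C j))"
      by (rule sum_mono) (simp add: \<tau>(3))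
    also have "\<dots> = frob_inner ((A * B * X)\<^sup>T * C) ((A * B * X)\<^sup>T * C)"
      by (simp add: frob_inner_columns[of "(A * B * X)\<^sup>T * C"] column_mult)
    finally show "\<tau> * frob_inner (P * C) (P * C) \<le> frob_inner ((A * B * X)\<^sup>T * C) ((A * B * X)\<^sup>T * C)" .
  qed
qed

text \<open>
  An Eckart-Young argument without singular vectors. Let \<open>Q\<close> be the orthogonal projection onto the
  range of \<open>A'\<close> and split the displacement as \<open>A' B' - A B = V + D\<close> with \<open>V = A' B' - Q A B\<close> inside
  and \<open>D = Q A B - A B\<close> orthogonal to that range. The gradient sees only \<open>U V\<close> with
  \<open>U = (1 - P) Q\<close>, and by the spectral gap its contribution is at least
  \<open>- (\<tau> \<parallel>U\<parallel>\<^sup>2 + \<parallel>V X\<parallel>\<^sup>2) / 2\<close>. The second summand cancels against the quadratic term of \<open>V\<close>.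
  The quadratic term of \<open>D\<close> compensates the first one: \<open>\<parallel>D X\<parallel>\<^sup>2 \<ge> \<tau> \<parallel>P (1 - Q)\<parallel>\<^sup>2\<close>, and
  \<open>\<parallel>P (1 - Q)\<parallel> = \<parallel>(1 - P) Q\<parallel>\<close> because \<open>P\<close> and \<open>Q\<close> have equal rank.
\<close>

lemma global_against_injective:
  assumes [simp]: "dim_row A' = dim_row A" "dim_col A' = dim_col A" "dim_row B' = dim_col A" "dim_col B' = dim_col B"
    and inj: "has_left_inverse A'"
  shows "loss X Y (A * B) \<le> loss X Y (A' * B')"
proof -
  have "\<not> has_kernel A'" using inj left_inverse_no_kernel by blast
  then obtain L where L: "L \<in> carrier_mat (dim_col A) (dim_row A)" "L * A' = 1\<^sub>m (dim_col A)" "(A' * L)\<^sup>T = A' * L"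
    using symmetric_left_inverse_or_kernel[of A'] by auto
  note [simp] = carrier_matD[OF L(1)]
  define Q where "Q = A' * L"
  have [simp]: "dim_row Q = dim_row A" "dim_col Q = dim_row A" by (simp_all add: Q_def)
  have Q_sym: "Q\<^sup>T = Q" by (simp add: Q_def L(3))
  have QA: "Q * A' = A'" by (simp add: Q_def mult_assoc_dim L(2))
  have Q_idem: "Q * Q = Q" using mult_assoc_dim[of Q A' L] by (simp add: QA flip: Q_def)
  define D where "D = Q * A * B - A * B"
  define V where "V = A' * B' - Q * A * B"
  define U where "U = Q - P * Q"
  have [simp]: "dim_row D = dim_row A" "dim_col D = dim_col B" "dim_row V = dim_row A" "dim_col V = dim_col B"
    "dim_row U = dim_row A" "dim_col U = dim_row A" by (simp_all add: D_def V_def U_def)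
  have QQM: "Q * (Q * M) = Q * M" if "dim_row M = dim_row A" for M
    using mult_assoc_dim[of Q Q M] that by (simp add: Q_idem)
  have QA'M: "Q * (A' * M) = A' * M" if "dim_row M = dim_col A" for M
    using mult_assoc_dim[of Q A' M] that by (simp add: QA)
  have QV: "Q * V = V" by (simp add: V_def mat_dim QQM QA'M)
  have QD: "Q * D = 0\<^sub>m (dim_row A) (dim_col B)"
    by (simp add: D_def mat_dim QQM minus_self)
  have AU: "A\<^sup>T * U = 0\<^sub>m (dim_col A) (dim_row A)"
  proof -
    have "A\<^sup>T * (P * Q) = A\<^sup>T * Q" by (simp add: At_P flip: mult_assoc_dim)
    then show ?thesis
      by (simp add: U_def mat_dim minus_self)
  qed
  have G_right: "frob_inner G (M * B) = 0" if [simp]: "dim_row M = dim_row A" "dim_col M = dim_col A" for M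
  proof -
    have "frob_inner G (M * B) = frob_inner (M * B) G" by (rule frob_inner_commute) simp_all
    also have "\<dots> = 0" by (simp add: frob_inner_mult_right G_Bt frob_inner_zero_right)
    finally show ?thesis .
  qed
  have G_left: "frob_inner G (A * M) = 0" if [simp]: "dim_row M = dim_col A" "dim_col M = dim_col B" for M
  proof -
    have "frob_inner G (A * M) = frob_inner (A * M) G" by (rule frob_inner_commute) simp_all
    also have "\<dots> = 0" by (simp add: frob_inner_mult_left At_G frob_inner_zero_right)
    finally show ?thesis .
  qed
  have AB': "A' * B' = A * B + (V + D)"
    by (intro eq_matI) (simp_all add: V_def D_def del: index_mult_mat(1))
  have GVD: "frob_inner G (V + D) = frob_inner G (U * V)"
  proof -
    have "frob_inner G D = 0" by (simp add: D_def frob_inner_minus_right G_right)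
    moreover have "U * V = V - A * (LA * V)"
      by (simp add: U_def mat_dim QV P_def)
    moreover have "frob_inner G (V - A * (LA * V)) = frob_inner G V" by (simp add: frob_inner_minus_right G_left)
    ultimately show ?thesis by (simp add: frob_inner_add_right)
  qed
  have orth: "frob_inner (V * X) (D * X) = 0"
  proof -
    have "frob_inner (V * X) (D * X) = frob_inner (Q * (V * X)) (D * X)" by (simp add: QV flip: mult_assoc_dim)
    also have "\<dots> = frob_inner (V * X) ((Q * D) * X)" by (subst frob_inner_mult_left) (simp_all add: Q_sym mult_assoc_dim)
    also have "\<dots> = 0" by (simp add: QD zero_mult_dim frob_inner_zero_right)
    finally show ?thesis .
  qed
  have norm: "frob_inner ((V + D) * X) ((V + D) * X) = frob_inner (V * X) (V * X) + frob_inner (D * X) (D * X)"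
  proof -
    have "frob_inner (D * X) (V * X) = 0" using orth by (subst frob_inner_commute) simp_all
    then show ?thesis by (simp add: mat_dim frob_inner_linear orth)
  qed
  obtain \<tau> where \<tau>: "0 \<le> \<tau>"
    "- (1 / 2) * (\<tau> * frob_inner U U + frob_inner (V * X) (V * X)) \<le> frob_inner G (U * V)"
    "\<tau> * frob_inner (P * (1\<^sub>m (dim_row A) - Q)) (P * (1\<^sub>m (dim_row A) - Q))
      \<le> frob_inner ((A * B * X)\<^sup>T * (1\<^sub>m (dim_row A) - Q)) ((A * B * X)\<^sup>T * (1\<^sub>m (dim_row A) - Q))"
  proof (rule spectral_gap_mat)
    fix \<tau>
    assume 1: "0 \<le> \<tau>" and 2: "\<And>U V. dim_row U = dim_row A \<Longrightarrow> dim_row V = dim_col U \<Longrightarrow> dim_col V = dim_col B \<Longrightarrow>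
        A\<^sup>T * U = 0\<^sub>m (dim_col A) (dim_col U) \<Longrightarrow>
        - (1 / 2) * (\<tau> * frob_inner U U + frob_inner (V * X) (V * X)) \<le> frob_inner G (U * V)"
      and 3: "\<And>C. dim_row C = dim_row A \<Longrightarrow>
        \<tau> * frob_inner (P * C) (P * C) \<le> frob_inner ((A * B * X)\<^sup>T * C) ((A * B * X)\<^sup>T * C)"
    show thesis by (rule that[OF 1 2 3]) (simp_all add: AU)
  qed
  have traces: "frob_inner (P * (1\<^sub>m (dim_row A) - Q)) (P * (1\<^sub>m (dim_row A) - Q)) = frob_inner U U"
  proof -
    have "frob_inner Q Q = dim_col A" "frob_inner P P = dim_col A"
      using frob_inner_projection[of L A'] frob_inner_projection[of LA A] L left_inv proj_sym by (simp_all add: Q_def P_def)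
    moreover have "frob_inner (P * Q) Q = frob_inner P Q" by (subst frob_inner_mult_right) (simp_all add: Q_sym Q_idem)
    moreover have "frob_inner (P * Q) P = frob_inner Q P" by (subst frob_inner_mult_left) (simp_all add: P_sym P_idem)
    moreover have "frob_inner Q (P * Q) = frob_inner (P * Q) Q" "frob_inner P (P * Q) = frob_inner (P * Q) P" "frob_inner P Q = frob_inner Q P"
      by (rule frob_inner_commute; simp)+
    ultimately show ?thesis by (simp add: U_def mat_dim frob_inner_linear)
  qed
  have "(A * B * X)\<^sup>T * (1\<^sub>m (dim_row A) - Q) = - 1 \<cdot>\<^sub>m (D * X)\<^sup>T"
  proof -
    have "(A * B * X)\<^sup>T * (1\<^sub>m (dim_row A) - Q) = (A * B * X)\<^sup>T - (Q * (A * B * X))\<^sup>T"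
      by (simp add: mult_minus_distrib_dim trans_dim Q_sym)
    also have "\<dots> = (A * B * X - Q * (A * B * X))\<^sup>T" by (simp add: transpose_minus_dim)
    also have "A * B * X - Q * (A * B * X) = - 1 \<cdot>\<^sub>m (D * X)"
      unfolding D_def by (simp add: mat_dim, intro eq_matI) (simp_all del: index_mult_mat(1))
    finally show ?thesis by (simp add: transpose_smult_dim)
  qed
  then have "frob_inner ((A * B * X)\<^sup>T * (1\<^sub>m (dim_row A) - Q)) ((A * B * X)\<^sup>T * (1\<^sub>m (dim_row A) - Q)) = frob_inner (D * X) (D * X)"
    by (simp add: frob_inner_linear frob_inner_transpose del: transpose_mult)
  with \<tau>(3) traces have "\<tau> * frob_inner U U \<le> frob_inner (D * X) (D * X)" by simp
  with \<tau>(2) have "0 \<le> frob_inner G (U * V) + 1 / 2 * (frob_inner (V * X) (V * X) + frob_inner (D * X) (D * X))"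
    by (simp add: distrib_left)
  then show ?thesis
    unfolding AB' by (simp add: loss_expand GVD norm flip: G_def)
qed

text \<open>
  A competitor \<open>A'\<close> without left inverse is approximated by the left-invertible \<open>A' + t A\<close>, \<open>t \<rightarrow> 0\<close>.
\<close>

theorem two_layer_minimum_is_global:
  assumes [simp]: "dim_row A' = dim_row A" "dim_col A' = dim_col A" "dim_row B' = dim_col A" "dim_col B' = dim_col B"
  shows "loss X Y (A * B) \<le> loss X Y (A' * B')"
proof -
  have "has_left_inverse A"
    unfolding has_left_inverse_def using left_inv by (intro bexI[of _ LA]) (auto intro!: carrier_matI)
  then have "eventually (\<lambda>t. has_left_inverse (A' + t \<cdot>\<^sub>m A)) (at_right (0::real))"
    by (intro eventually_has_left_inverse) simp_all
  then have "eventually (\<lambda>t. loss X Y (A * B) \<le> loss X Y ((A' + t \<cdot>\<^sub>m A) * B')) (at_right (0::real))"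
    by (rule eventually_mono) (rule global_against_injective; simp)
  moreover have "((\<lambda>t. loss X Y ((A' + t \<cdot>\<^sub>m A) * B')) \<longlongrightarrow> loss X Y (A' * B')) (at_right (0::real))"
  proof -
    define R where "R = (A' * B' * X - Y) * X\<^sup>T"
    have [simp]: "dim_row R = dim_row A" "dim_col R = dim_col B" by (simp_all add: R_def)
    have "loss X Y ((A' + t \<cdot>\<^sub>m A) * B') = loss X Y (A' * B') + t * frob_inner R (A * B')
        + 1 / 2 * (t * (t * frob_inner (A * B' * X) (A * B' * X)))" for t
    proof -
      have "(A' + t \<cdot>\<^sub>m A) * B' = A' * B' + t \<cdot>\<^sub>m (A * B')" by (simp add: mat_dim)
      moreover have "t \<cdot>\<^sub>m (A * B') * X = t \<cdot>\<^sub>m (A * B' * X)" by (simp add: smult_mult_dim)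
      ultimately show ?thesis by (simp add: loss_expand frob_inner_linear flip: R_def)
    qed
    moreover have "((\<lambda>t. loss X Y (A' * B') + t * frob_inner R (A * B')
        + 1 / 2 * (t * (t * frob_inner (A * B' * X) (A * B' * X)))) \<longlongrightarrow> loss X Y (A' * B') + 0 * frob_inner R (A * B')
        + 1 / 2 * (0 * (0 * frob_inner (A * B' * X) (A * B' * X)))) (at_right (0::real))"
      by (intro tendsto_intros)
    ultimately show ?thesis by simp
  qed
  ultimately show ?thesis
    by (intro tendsto_lowerbound[of "\<lambda>t. loss X Y ((A' + t \<cdot>\<^sub>m A) * B')" _ "at_right 0"]) auto
qed

end

section \<open>Products of consecutive layers\<close>

text \<open>
  For \<open>i \<le> j\<close> this is \<open>W j * \<dots> * W (i + 1)\<close>, the map from layer \<open>i\<close> to layer \<open>j\<close>. Unlike the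
  network output it starts at an arbitrary layer and can be cut at every intermediate one; the heads
  of the network are the chains from \<open>0\<close>, the tails the chains to \<open>h\<close>.
\<close>

primrec chain :: "(nat \<Rightarrow> nat) \<Rightarrow> (nat \<Rightarrow> real mat) \<Rightarrow> nat \<Rightarrow> nat \<Rightarrow> real mat" where
  "chain d W i 0 = 1\<^sub>m (d i)"
| "chain d W i (Suc j) = (if Suc j \<le> i then 1\<^sub>m (d i) else W (Suc j) * chain d W i j)"

lemma chain_refl [simp]: "chain d W i i = 1\<^sub>m (d i)"
  by (cases i) auto

lemma params_dim:
  assumes "W \<in> dln_params h d" "1 \<le> i" "i \<le> h"
  shows "dim_row (W i) = d i" "dim_col (W i) = d (i - 1)" "W i \<in> carrier_mat (d i) (d (i - 1))"
  using assms unfolding dln_params_def by auto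

lemma chain_dim:
  assumes "W \<in> dln_params h d" "i \<le> j" "j \<le> h"
  shows "dim_row (chain d W i j) = d j" "dim_col (chain d W i j) = d i"
proof -
  have "dim_row (chain d W i j) = d j \<and> dim_col (chain d W i j) = d i"
    using assms(2,3)
  proof (induction j)
    case (Suc j)
    show ?case
    proof (cases "i = Suc j")
      case False
      then have "i \<le> j" "\<not> Suc j \<le> i" using Suc.prems by auto
      then show ?thesis using Suc params_dim[OF assms(1), of "Suc j"] by auto
    qed auto
  qed auto
  then show "dim_row (chain d W i j) = d j" "dim_col (chain d W i j) = d i" by auto
qed

lemma chain_cong:
  assumes "\<And>m. i < m \<Longrightarrow> m \<le> j \<Longrightarrow> W m = V m"
  shows "chain d W i j = chain d V i j"
  using assms by (induction j) auto

lemma chain_split: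
  assumes W: "W \<in> dln_params h d" and "i \<le> k" "k \<le> j" "j \<le> h"
  shows "chain d W i j = chain d W k j * chain d W i k"
  using assms(3,4)
proof (induction j)
  case 0
  then show ?case using \<open>i \<le> k\<close> by simp
next
  case (Suc j)
  show ?case
  proof (cases "k = Suc j")
    case True
    then show ?thesis
      using chain_dim[OF W \<open>i \<le> k\<close>] Suc.prems by (auto intro!: one_mult_dim[symmetric])
  next
    case False
    then have kj: "k \<le> j" "j \<le> h" using Suc.prems by auto
    then have "chain d W i (Suc j) = W (Suc j) * (chain d W k j * chain d W i k)"
      using Suc.IH \<open>i \<le> k\<close> by simp
    also have "\<dots> = W (Suc j) * chain d W k j * chain d W i k"
      using kj \<open>i \<le> k\<close> Suc.prems chain_dim[OF W] params_dim[OF W, of "Suc j"]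
      by (intro mult_assoc_dim[symmetric]) auto
    finally show ?thesis using kj by simp
  qed
qed

lemma chain_step:
  assumes W: "W \<in> dln_params h d" and "1 \<le> k" "k \<le> h"
  shows "chain d W (k - 1) k = W k"
  using assms params_dim[OF W, of k] by (cases k) auto

lemma chain_drop_first:
  assumes W: "W \<in> dln_params h d" and "i < j" "j \<le> h"
  shows "chain d W i j = chain d W (Suc i) j * W (Suc i)"
  using chain_split[OF W, of i "Suc i" j] chain_step[OF W, of "Suc i"] assms by simp

lemma chain_drop_last:
  assumes "i < j"
  shows "chain d W i j = W j * chain d W i (j - 1)"
  using assms by (cases j) auto

lemma dln_output_chain:
  assumes W: "W \<in> dln_params h d" and "k \<le> h" "dim_row X = d 0"
  shows "dln_output W k X = chain d W 0 k * X"
  using assms(2)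
proof (induction k)
  case 0
  then show ?case using assms(3) by simp
next
  case (Suc k)
  then show ?case
    using chain_dim[OF W, of 0 k] params_dim[OF W, of "Suc k"] assms(3) by (simp add: mult_assoc_dim)
qed

lemma chain_update:
  assumes W: "W \<in> dln_params h d" and k: "1 \<le> k" "k \<le> h" and M: "M \<in> carrier_mat (d k) (d (k - 1))" and "i < k" "k \<le> j" "j \<le> h"
  shows "chain d (W(k := M)) i j = chain d W k j * (M * chain d W i (k - 1))"
proof -
  let ?V = "W(k := M)"
  have V: "?V \<in> dln_params h d" using W M unfolding dln_params_def by auto
  have "chain d ?V i j = chain d ?V k j * chain d ?V i k"
    using assms by (intro chain_split[OF V]) auto
  also have "chain d ?V i k = M * chain d ?V i (k - 1)" using chain_drop_last[OF \<open>i < k\<close>] by simp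
  also have "chain d ?V i (k - 1) = chain d W i (k - 1)" using k by (intro chain_cong) auto
  also have "chain d ?V k j = chain d W k j" by (intro chain_cong) auto
  finally show ?thesis .
qed

lemma chain_through:
  assumes W: "W \<in> dln_params h d" and k: "1 \<le> k" and "i < k" "k \<le> j" "j \<le> h"
  shows "chain d W i j = chain d W k j * (W k * chain d W i (k - 1))"
  using chain_update[OF W k(1) _ params_dim(3)[OF W k(1)], of i j] assms by simp

section \<open>Local minima and flat moves\<close>

text \<open>
  Closeness entry by entry defines the same local minima as the Euclidean distance and is easier to
  handle under updates of one layer, composition of moves and transposition.
\<close>

definition near :: "nat \<Rightarrow> (nat \<Rightarrow> nat) \<Rightarrow> real \<Rightarrow> (nat \<Rightarrow> real mat) \<Rightarrow> (nat \<Rightarrow> real mat) \<Rightarrow> bool" where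
  "near h d \<epsilon> W V \<longleftrightarrow> (\<forall>i\<in>{1..h}. \<forall>a<d i. \<forall>b<d (i - 1). \<bar>V i $$ (a, b) - W i $$ (a, b)\<bar> < \<epsilon>)"

text \<open>
  Local minima of an arbitrary function \<open>\<phi>\<close> of the end-to-end matrix. This generality makes the
  notion stable under reversal of the network, which turns \<open>\<phi>\<close> into \<open>\<lambda>M. \<phi> (M\<^sup>T)\<close>.
\<close>

definition local_min :: "nat \<Rightarrow> (nat \<Rightarrow> nat) \<Rightarrow> (real mat \<Rightarrow> real) \<Rightarrow> (nat \<Rightarrow> real mat) \<Rightarrow> bool" where
  "local_min h d \<phi> W \<longleftrightarrow> W \<in> dln_params h d \<and>
    (\<exists>\<epsilon>>0. \<forall>V\<in>dln_params h d. near h d \<epsilon> W V \<longrightarrow> \<phi> (chain d W 0 h) \<le> \<phi> (chain d V 0 h))"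

lemma near_trans:
  assumes "near h d \<epsilon> W V" "near h d \<delta> V U" shows "near h d (\<epsilon> + \<delta>) W U"
  unfolding near_def
proof (intro ballI allI impI)
  fix i a b assume "i \<in> {1..h}" "a < d i" "b < d (i - 1)"
  then have "\<bar>V i $$ (a, b) - W i $$ (a, b)\<bar> < \<epsilon>" "\<bar>U i $$ (a, b) - V i $$ (a, b)\<bar> < \<delta>"
    using assms unfolding near_def by auto
  then show "\<bar>U i $$ (a, b) - W i $$ (a, b)\<bar> < \<epsilon> + \<delta>" by linarith
qed

lemma near_update:
  assumes "0 < \<epsilon>" and E: "E \<in> carrier_mat (d k) (d (k - 1))"
  obtains \<delta> where "0 < \<delta>" "\<And>W t. \<bar>t\<bar> < \<delta> \<Longrightarrow> near h d \<epsilon> W (W(k := W k + t \<cdot>\<^sub>m E))"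
proof -
  define c where "c = (\<Sum>a<d k. \<Sum>b<d (k - 1). \<bar>E $$ (a, b)\<bar>)"
  have c0: "0 \<le> c" unfolding c_def by (intro sum_nonneg) auto
  have c: "\<bar>E $$ (a, b)\<bar> \<le> c" if "a < d k" "b < d (k - 1)" for a b
  proof -
    have "\<bar>E $$ (a, b)\<bar> \<le> (\<Sum>b<d (k - 1). \<bar>E $$ (a, b)\<bar>)"
      using that by (intro member_le_sum) auto
    also have "\<dots> \<le> c"
      unfolding c_def using that by (intro member_le_sum[of a _ "\<lambda>a. \<Sum>b<d (k - 1). \<bar>E $$ (a, b)\<bar>"] sum_nonneg) auto
    finally show ?thesis .
  qed
  show thesis
  proof (rule that[of "\<epsilon> / (c + 1)"])
    show "0 < \<epsilon> / (c + 1)" using assms(1) c0 by simp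
    fix W t assume t: "\<bar>t\<bar> < \<epsilon> / (c + 1)"
    have "\<bar>(W(k := W k + t \<cdot>\<^sub>m E)) i $$ (a, b) - W i $$ (a, b)\<bar> < \<epsilon>"
      if "a < d i" "b < d (i - 1)" for i a b
    proof (cases "i = k")
      case True
      then have "\<bar>t\<bar> * \<bar>E $$ (a, b)\<bar> \<le> \<bar>t\<bar> * (c + 1)" using c[of a b] that by (intro mult_left_mono) auto
      also have "\<dots> < \<epsilon>" using t c0 by (simp add: pos_less_divide_eq)
      finally show ?thesis using True that E by (simp add: abs_mult)
    qed (use assms(1) in simp)
    then show "near h d \<epsilon> W (W(k := W k + t \<cdot>\<^sub>m E))" unfolding near_def by auto
  qed
qed

lemma params_update:
  assumes "W \<in> dln_params h d" "E \<in> carrier_mat (d k) (d (k - 1))"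
  shows "W(k := W k + t \<cdot>\<^sub>m E) \<in> dln_params h d"
  using assms unfolding dln_params_def by auto

text \<open>
  A sufficiently near point with the same end-to-end matrix is again a local minimum, with half the
  radius.
\<close>

lemma local_min_flat_move:
  assumes W: "local_min h d \<phi> W" and E: "E \<in> carrier_mat (d k) (d (k - 1))"
    and flat: "\<And>t. chain d (W(k := W k + t \<cdot>\<^sub>m E)) 0 h = chain d W 0 h"
  obtains t where "t \<noteq> 0" "local_min h d \<phi> (W(k := W k + t \<cdot>\<^sub>m E))"
proof -
  obtain \<epsilon> where \<epsilon>: "0 < \<epsilon>" "\<And>V. V \<in> dln_params h d \<Longrightarrow> near h d \<epsilon> W V \<Longrightarrow> \<phi> (chain d W 0 h) \<le> \<phi> (chain d V 0 h)"
    using W unfolding local_min_def by auto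
  obtain \<delta> where \<delta>: "0 < \<delta>" "\<And>W t. \<bar>t\<bar> < \<delta> \<Longrightarrow> near h d (\<epsilon> / 2) W (W(k := W k + t \<cdot>\<^sub>m E))"
    using near_update[OF _ E, of "\<epsilon> / 2"] \<epsilon>(1) by auto
  let ?V = "W(k := W k + (\<delta> / 2) \<cdot>\<^sub>m E)"
  show thesis
  proof (rule that[of "\<delta> / 2"])
    show "\<delta> / 2 \<noteq> 0" using \<delta>(1) by simp
    show "local_min h d \<phi> ?V"
      unfolding local_min_def
    proof (intro conjI exI[of _ "\<epsilon> / 2"] ballI impI)
      show "?V \<in> dln_params h d" using W E params_update unfolding local_min_def by blast
      fix U assume "U \<in> dln_params h d" "near h d (\<epsilon> / 2) ?V U"
      moreover have "near h d (\<epsilon> / 2) W ?V" using \<delta> by simp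
      ultimately have "near h d \<epsilon> W U" using near_trans[of h d "\<epsilon> / 2" W ?V "\<epsilon> / 2" U] by simp
      then show "\<phi> (chain d ?V 0 h) \<le> \<phi> (chain d U 0 h)"
        unfolding flat using \<epsilon>(2) \<open>U \<in> dln_params h d\<close> by blast
    qed (use \<epsilon>(1) in simp)
  qed
qed

section \<open>Vanishing of the gradient\<close>

text \<open>
  \<open>G\<close> is the gradient of \<open>\<phi>\<close> at \<open>M\<close>, and \<open>\<phi>\<close> is a quadratic polynomial on each line through \<open>M\<close>.
\<close>

definition quadratic_at :: "(real mat \<Rightarrow> real) \<Rightarrow> real mat \<Rightarrow> real mat \<Rightarrow> bool" where
  "quadratic_at \<phi> M G \<longleftrightarrow> dim_row G = dim_row M \<and> dim_col G = dim_col M \<and>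
    (\<forall>E\<in>carrier_mat (dim_row M) (dim_col M). \<exists>c. \<forall>t. \<phi> (M + t \<cdot>\<^sub>m E) = \<phi> M + frob_inner G E * t + c * t ^ 2)"

lemma local_min_critical:
  assumes W: "local_min h d \<phi> W" and G: "quadratic_at \<phi> (chain d W 0 h) G" and k: "1 \<le> k" "k \<le> h"
    and E: "E \<in> carrier_mat (d k) (d (k - 1))"
  shows "frob_inner G (chain d W k h * (E * chain d W 0 (k - 1))) = 0"
proof -
  note [simp del] = One_nat_def
  obtain \<epsilon> where Wp: "W \<in> dln_params h d" and \<epsilon>: "0 < \<epsilon>"
    "\<And>V. V \<in> dln_params h d \<Longrightarrow> near h d \<epsilon> W V \<Longrightarrow> \<phi> (chain d W 0 h) \<le> \<phi> (chain d V 0 h)"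
    using W unfolding local_min_def by auto
  obtain \<delta> where \<delta>: "0 < \<delta>" "\<And>W t. \<bar>t\<bar> < \<delta> \<Longrightarrow> near h d \<epsilon> W (W(k := W k + t \<cdot>\<^sub>m E))"
    using near_update[OF \<epsilon>(1) E] by auto
  let ?L = "chain d W k h" and ?R = "chain d W 0 (k - 1)" and ?M = "chain d W 0 h"
  have [simp]: "dim_row ?L = d h" "dim_col ?L = d k" "dim_row ?R = d (k - 1)" "dim_col ?R = d 0"
    "dim_row ?M = d h" "dim_col ?M = d 0" "dim_row (W k) = d k" "dim_col (W k) = d (k - 1)"
    "dim_row E = d k" "dim_col E = d (k - 1)"
    using chain_dim[OF Wp] params_dim[OF Wp] k E by auto
  have move: "chain d (W(k := W k + t \<cdot>\<^sub>m E)) 0 h = ?M + t \<cdot>\<^sub>m (?L * (E * ?R))" for t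
  proof -
    have "chain d (W(k := W k + t \<cdot>\<^sub>m E)) 0 h = ?L * ((W k + t \<cdot>\<^sub>m E) * ?R)"
      using k by (intro chain_update[OF Wp]) (auto intro!: carrier_matI)
    also have "\<dots> = ?L * (W k * ?R) + t \<cdot>\<^sub>m (?L * (E * ?R))"
      by (simp add: add_mult_distrib_dim mult_add_distrib_dim smult_mult_dim mult_smult_dim)
    also have "?L * (W k * ?R) = ?M" using k by (intro chain_through[OF Wp, symmetric]) auto
    finally show ?thesis .
  qed
  obtain c where c: "\<And>t. \<phi> (?M + t \<cdot>\<^sub>m (?L * (E * ?R))) = \<phi> ?M + frob_inner G (?L * (E * ?R)) * t + c * t ^ 2"
    using G unfolding quadratic_at_def by (force intro: carrier_matI)
  have "0 \<le> frob_inner G (?L * (E * ?R)) * t + c * t ^ 2 + 0 * t ^ 3 + 0 * t ^ 4" if "\<bar>t\<bar> < \<delta>" for t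
    using \<epsilon>(2)[OF params_update[OF Wp E] \<delta>(2)[OF that]] unfolding move c by simp
  from quartic_minimum_at_0(1)[OF \<delta>(1) this] show ?thesis .
qed

text \<open>
  If the tail has the right inverse \<open>S\<^sup>T\<close>, then \<open>S\<^sup>T (G R\<^sup>T)\<close> is a direction in layer \<open>k\<close>
  along which the derivative of \<open>\<phi>\<close> is \<open>\<parallel>G R\<^sup>T\<parallel>\<^sup>2\<close>.
\<close>

lemma gradient_right_zero:
  assumes W: "local_min h d \<phi> W" and G: "quadratic_at \<phi> (chain d W 0 h) G" and k: "1 \<le> k" "k \<le> h"
    and surj: "has_left_inverse ((chain d W k h)\<^sup>T)"
  shows "G * (chain d W 0 (k - 1))\<^sup>T = 0\<^sub>m (d h) (d (k - 1))"
proof -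
  note [simp del] = One_nat_def
  have Wp: "W \<in> dln_params h d" using W unfolding local_min_def by auto
  let ?L = "chain d W k h" and ?R = "chain d W 0 (k - 1)"
  have [simp]: "dim_row ?L = d h" "dim_col ?L = d k" "dim_row ?R = d (k - 1)" "dim_col ?R = d 0"
    "dim_row G = d h" "dim_col G = d 0"
    using chain_dim[OF Wp] k G unfolding quadratic_at_def by auto
  obtain S where S: "S \<in> carrier_mat (d h) (d k)" "S * ?L\<^sup>T = 1\<^sub>m (d h)"
    using surj unfolding has_left_inverse_def by auto
  note [simp] = carrier_matD[OF S(1)]
  have LS: "?L * S\<^sup>T = 1\<^sub>m (d h)"
    using arg_cong[OF S(2), of transpose_mat] by (simp add: transpose_mult_dim[of S])
  let ?K = "G * ?R\<^sup>T"
  have "frob_inner G (?L * ((S\<^sup>T * ?K) * ?R)) = 0"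
    by (rule local_min_critical[OF W G k]) (auto intro!: carrier_matI)
  also have "?L * ((S\<^sup>T * ?K) * ?R) = (?L * S\<^sup>T) * ?K * ?R" by (simp add: mult_assoc_dim)
  also have "\<dots> = ?K * ?R" by (simp add: LS)
  also have "frob_inner G (?K * ?R) = frob_inner (?K * ?R) G" by (rule frob_inner_commute) simp_all
  also have "\<dots> = frob_inner ?K ?K" by (simp add: frob_inner_mult_right)
  finally show ?thesis using frob_inner_eq_0[of ?K] by simp
qed

text \<open>
  Downward induction on \<open>j\<close>, over all local minima that satisfy the hypotheses. If \<open>b\<close> is in the
  kernel of the tail at \<open>j + 1\<close>, adding \<open>t b s\<^sup>T\<close> to \<open>W (j + 1)\<close> preserves all tails, hence the
  hypotheses and \<open>G\<close>. The induction hypothesis before and after the move gives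
  \<open>G R\<^sup>T s b\<^sup>T = 0\<close> for the head \<open>R\<close> at \<open>j\<close> and all \<open>s\<close>.
\<close>

lemma gradient_zero_below_surjective_layer:
  assumes "local_min h d \<phi> W" "quadratic_at \<phi> (chain d W 0 h) G" and k: "1 \<le> k" "k \<le> h"
    and "has_left_inverse ((chain d W k h)\<^sup>T)" "\<And>j. 1 \<le> j \<Longrightarrow> j < k \<Longrightarrow> has_kernel (chain d W j h)"
    and "j < k"
  shows "G * (chain d W 0 j)\<^sup>T = 0\<^sub>m (d h) (d j)"
proof -
  have "j \<le> k - 1" using \<open>j < k\<close> by simp
  then show ?thesis
    using assms(1,2,5,6)
  proof (induction arbitrary: W rule: inc_induct)
    case base
    then show ?case using gradient_right_zero k by blast
  next
    case (step j)
    note W = step.prems(1) and G = step.prems(2) and surj = step.prems(3) and ker = step.prems(4)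
    have Wp: "W \<in> dln_params h d" using W unfolding local_min_def by auto
    let ?j = "Suc j"
    have jk: "?j < k" "1 \<le> ?j" "?j \<le> h" using step.hyps k by auto
    let ?L = "chain d W ?j h" and ?R = "chain d W 0 j"
    have [simp]: "dim_row ?L = d h" "dim_col ?L = d ?j" "dim_row ?R = d j" "dim_col ?R = d 0"
      "dim_row G = d h" "dim_col G = d 0" "dim_row (W ?j) = d ?j" "dim_col (W ?j) = d j"
      using chain_dim[OF Wp] params_dim[OF Wp, of ?j] jk G unfolding quadratic_at_def by auto
    obtain b where b: "b \<in> carrier_mat (d ?j) 1" "b \<noteq> 0\<^sub>m (d ?j) 1" "?L * b = 0\<^sub>m (d h) 1"
      using ker[of ?j] jk unfolding has_kernel_def by auto
    note [simp] = carrier_matD[OF b(1)]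
    let ?K = "G * ?R\<^sup>T"
    have "?K * s = 0\<^sub>m (d h) 1" if s: "s \<in> carrier_mat (d j) 1" for s
    proof -
      note [simp] = carrier_matD[OF s]
      let ?E = "b * s\<^sup>T"
      have E: "?E \<in> carrier_mat (d ?j) (d (?j - 1))" by (auto intro!: carrier_matI)
      have same: "chain d (W(?j := W ?j + t \<cdot>\<^sub>m ?E)) i h = chain d W i h" if "i \<le> h" for i t
      proof (cases "i < ?j")
        case True
        let ?Ri = "chain d W i j"
        have [simp]: "dim_row ?Ri = d j" "dim_col ?Ri = d i" using chain_dim[OF Wp] True jk by auto
        have "chain d (W(?j := W ?j + t \<cdot>\<^sub>m ?E)) i h = ?L * ((W ?j + t \<cdot>\<^sub>m ?E) * ?Ri)"
          using True jk by (intro chain_update[OF Wp jk(2,3), of "W ?j + t \<cdot>\<^sub>m ?E" i h, unfolded diff_Suc_1])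
            (auto intro!: carrier_matI)
        also have "\<dots> = ?L * (W ?j * ?Ri) + t \<cdot>\<^sub>m ((?L * b) * (s\<^sup>T * ?Ri))"
          by (simp add: mat_dim)
        also have "\<dots> = ?L * (W ?j * ?Ri)"
          unfolding b(3) by (intro eq_matI) (simp_all add: zero_mult_dim del: index_mult_mat(1))
        also have "\<dots> = chain d W i h" using chain_through[OF Wp jk(2) True, of h] jk by simp
        finally show ?thesis .
      next
        case False
        then show ?thesis by (intro chain_cong) auto
      qed
      obtain t where t: "t \<noteq> 0" "local_min h d \<phi> (W(?j := W ?j + t \<cdot>\<^sub>m ?E))"
        using local_min_flat_move[OF W E] same by auto
      define V where "V = W(?j := W ?j + t \<cdot>\<^sub>m ?E)"
      have V_same: "chain d V i h = chain d W i h" if "i \<le> h" for i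
        using same[OF that] by (simp add: V_def)
      have "G * (chain d V 0 ?j)\<^sup>T = 0\<^sub>m (d h) (d ?j)"
        by (rule step.IH[OF t(2)[folded V_def]]) (use G surj ker k in \<open>simp_all add: V_same\<close>)
      moreover have "chain d V 0 ?j = W ?j * ?R + t \<cdot>\<^sub>m (b * (s\<^sup>T * ?R))"
      proof -
        have "chain d V 0 ?j = (W ?j + t \<cdot>\<^sub>m ?E) * chain d V 0 j" by (simp add: V_def)
        also have "chain d V 0 j = ?R" unfolding V_def by (intro chain_cong) auto
        finally show ?thesis by (simp add: mat_dim)
      qed
      moreover have "G * (chain d W 0 ?j)\<^sup>T = 0\<^sub>m (d h) (d ?j)"
        by (rule step.IH[OF W G surj ker])
      moreover have "chain d W 0 ?j = W ?j * ?R" by simp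
      ultimately have sum: "G * (W ?j * ?R)\<^sup>T + t \<cdot>\<^sub>m (?K * s * b\<^sup>T) = 0\<^sub>m (d h) (d ?j)"
        and zero: "G * (W ?j * ?R)\<^sup>T = 0\<^sub>m (d h) (d ?j)"
        by (simp_all add: trans_dim mat_dim)
      have "?K * s * b\<^sup>T = 0\<^sub>m (d h) (d ?j)"
      proof (rule eq_matI)
        fix x y assume xy: "x < dim_row (0\<^sub>m (d h) (d ?j) :: real mat)" "y < dim_col (0\<^sub>m (d h) (d ?j) :: real mat)"
        show "(?K * s * b\<^sup>T) $$ (x, y) = 0\<^sub>m (d h) (d ?j) $$ (x, y)"
          using arg_cong[OF sum[unfolded zero], of "\<lambda>m. m $$ (x, y)"] xy t(1) by (simp del: index_mult_mat(1))
      qed simp_all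
      then have "?K * s * b\<^sup>T * b = 0\<^sub>m (d h) 1" by (simp add: zero_mult_dim)
      moreover have "?K * s * b\<^sup>T * b = frob_inner b b \<cdot>\<^sub>m (?K * s)"
        by (simp add: mat_dim column_contract)
      ultimately have scaled: "frob_inner b b \<cdot>\<^sub>m (?K * s) = 0\<^sub>m (d h) 1" by simp
      have bb: "frob_inner b b \<noteq> 0" using frob_inner_eq_0[of b] b(2) by auto
      show ?thesis
      proof (rule eq_matI)
        fix x y assume xy: "x < dim_row (0\<^sub>m (d h) 1 :: real mat)" "y < dim_col (0\<^sub>m (d h) 1 :: real mat)"
        show "(?K * s) $$ (x, y) = 0\<^sub>m (d h) 1 $$ (x, y)"
          using arg_cong[OF scaled, of "\<lambda>m. m $$ (x, y)"] xy bb by (simp del: index_mult_mat(1))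
      qed simp_all
    qed
    then show ?case using eq_zero_if_kills_columns[of ?K] by simp
  qed
qed

text \<open>
  The previous lemma is applied with the first layer whose tail has a right inverse, down to the empty
  head. Such a layer exists because the tail at \<open>h\<close> is the identity.
\<close>

lemma gradient_zero_if_tails_degenerate:
  assumes W: "local_min h d \<phi> W" and G: "quadratic_at \<phi> (chain d W 0 h) G" and h: "1 \<le> h"
    and dich: "\<And>j. 1 \<le> j \<Longrightarrow> j < h \<Longrightarrow> has_kernel (chain d W j h) \<or> has_left_inverse ((chain d W j h)\<^sup>T)"
  shows "G = 0\<^sub>m (d h) (d 0)"
proof -
  have Wp: "W \<in> dln_params h d" using W unfolding local_min_def by auto
  have [simp]: "dim_row G = d h" "dim_col G = d 0"
    using chain_dim[OF Wp, of 0 h] G unfolding quadratic_at_def by auto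
  define S where "S k \<longleftrightarrow> 1 \<le> k \<and> k \<le> h \<and> has_left_inverse ((chain d W k h)\<^sup>T)" for k
  have "has_left_inverse ((chain d W h h)\<^sup>T)"
    unfolding has_left_inverse_def by (intro bexI[of _ "1\<^sub>m (d h)"]) auto
  then have "S h" using h unfolding S_def by blast
  define k where "k = (LEAST k. S k)"
  have k: "S k" unfolding k_def by (rule LeastI[of S h]) fact
  have "has_kernel (chain d W j h)" if "1 \<le> j" "j < k" for j
  proof -
    have "\<not> S j" using not_less_Least[of j S] that by (simp add: k_def)
    then show ?thesis using dich[of j] that k unfolding S_def by auto
  qed
  then have "G * (chain d W 0 0)\<^sup>T = 0\<^sub>m (d h) (d 0)"
    using k unfolding S_def by (intro gradient_zero_below_surjective_layer[OF W G]) auto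
  then show ?thesis by simp
qed

section \<open>Reversing the network\<close>

text \<open>
  The parameters of the transposed network, whose layer \<open>i\<close> has width \<open>d (h - i)\<close>.
\<close>

definition reverse_params :: "nat \<Rightarrow> (nat \<Rightarrow> real mat) \<Rightarrow> nat \<Rightarrow> real mat" where
  "reverse_params h W i = (W (h + 1 - i))\<^sup>T"

lemma reverse_params_mem:
  assumes "W \<in> dln_params h d" shows "reverse_params h W \<in> dln_params h (\<lambda>i. d (h - i))"
  unfolding dln_params_def
proof (intro CollectI ballI)
  fix i assume i: "i \<in> {1..h}"
  then have "h - (i - 1) = h + 1 - i" "h - i = h + 1 - i - 1" by auto
  moreover have "W (h + 1 - i) \<in> carrier_mat (d (h + 1 - i)) (d (h + 1 - i - 1))"
    using params_dim(3)[OF assms, of "h + 1 - i"] i by auto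
  ultimately show "reverse_params h W i \<in> carrier_mat (d (h - i)) (d (h - (i - 1)))"
    unfolding reverse_params_def by simp
qed

lemma reverse_params_mem':
  assumes "V \<in> dln_params h (\<lambda>i. d (h - i))" shows "reverse_params h V \<in> dln_params h d"
proof -
  have "reverse_params h V \<in> dln_params h (\<lambda>i. d (h - (h - i)))"
    using reverse_params_mem[OF assms] .
  then show ?thesis unfolding dln_params_def by auto
qed

lemma chain_reverse:
  assumes W: "W \<in> dln_params h d" and "i \<le> j" "j \<le> h"
  shows "chain (\<lambda>i. d (h - i)) (reverse_params h W) i j = (chain d W (h - j) (h - i))\<^sup>T"
  using assms(2,3)
proof (induction j)
  case (Suc j)
  show ?case
  proof (cases "i = Suc j")
    case False
    then have ij: "i \<le> j" "Suc j \<le> h" using Suc.prems by auto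
    then have "chain (\<lambda>i. d (h - i)) (reverse_params h W) i (Suc j) = (W (h - j))\<^sup>T * (chain d W (h - j) (h - i))\<^sup>T"
      using Suc.IH reverse_params_def[of h W "Suc j"] by simp
    also have "\<dots> = (chain d W (h - j) (h - i) * W (h - j))\<^sup>T"
      using chain_dim[OF W, of "h - j" "h - i"] params_dim[OF W, of "h - j"] ij
      by (intro transpose_mult_dim[symmetric]) auto
    also have "chain d W (h - j) (h - i) * W (h - j) = chain d W (h - Suc j) (h - i)"
      using chain_drop_first[OF W, of "h - Suc j" "h - i"] ij by (simp add: Suc_diff_Suc)
    finally show ?thesis .
  qed simp
qed simp

lemma local_min_reverse:
  assumes W: "local_min h d \<phi> W"
  shows "local_min h (\<lambda>i. d (h - i)) (\<lambda>M. \<phi> (M\<^sup>T)) (reverse_params h W)"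
proof -
  let ?d = "\<lambda>i. d (h - i)"
  obtain \<epsilon> where Wp: "W \<in> dln_params h d" and \<epsilon>: "0 < \<epsilon>"
    "\<And>V. V \<in> dln_params h d \<Longrightarrow> near h d \<epsilon> W V \<Longrightarrow> \<phi> (chain d W 0 h) \<le> \<phi> (chain d V 0 h)"
    using W unfolding local_min_def by auto
  show ?thesis
    unfolding local_min_def
  proof (intro conjI exI[of _ \<epsilon>] ballI impI)
    show "reverse_params h W \<in> dln_params h ?d" using reverse_params_mem[OF Wp] .
    fix V assume V: "V \<in> dln_params h ?d" and nr: "near h ?d \<epsilon> (reverse_params h W) V"
    let ?U = "reverse_params h V"
    have U: "?U \<in> dln_params h d" using reverse_params_mem'[OF V] .
    have "near h d \<epsilon> W ?U"
      unfolding near_def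
    proof (intro ballI allI impI)
      fix i a b assume i: "i \<in> {1..h}" and ab: "a < d i" "b < d (i - 1)"
      let ?i = "h + 1 - i"
      have hi: "h + 1 - ?i = i" "h - ?i = i - 1" "h - (?i - 1) = i" "?i \<in> {1..h}" using i by auto
      then have "\<bar>V ?i $$ (b, a) - reverse_params h W ?i $$ (b, a)\<bar> < \<epsilon>"
        using nr ab unfolding near_def by metis
      moreover have "reverse_params h W ?i $$ (b, a) = W i $$ (a, b)"
        unfolding reverse_params_def hi(1) using params_dim[OF Wp, of i] i ab by simp
      moreover have "?U i $$ (a, b) = V ?i $$ (b, a)"
        unfolding reverse_params_def using params_dim[OF V, of ?i] hi ab by simp
      ultimately show "\<bar>?U i $$ (a, b) - W i $$ (a, b)\<bar> < \<epsilon>" by simp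
    qed
    then have "\<phi> (chain d W 0 h) \<le> \<phi> (chain d ?U 0 h)" using \<epsilon>(2)[OF U] by blast
    moreover have "chain ?d V 0 h = (chain d ?U 0 h)\<^sup>T"
    proof -
      have "chain ?d V 0 h = chain ?d (reverse_params h ?U) 0 h"
        by (intro chain_cong) (simp add: reverse_params_def)
      then show ?thesis using chain_reverse[OF U, of 0 h] by simp
    qed
    ultimately show "\<phi> ((chain ?d (reverse_params h W) 0 h)\<^sup>T) \<le> \<phi> ((chain ?d V 0 h)\<^sup>T)"
      using chain_reverse[OF Wp, of 0 h] by simp
  qed (fact \<epsilon>(1))
qed

lemma quadratic_at_transpose:
  assumes "quadratic_at \<phi> M G" shows "quadratic_at (\<lambda>M. \<phi> (M\<^sup>T)) (M\<^sup>T) (G\<^sup>T)"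
  unfolding quadratic_at_def
proof (intro conjI ballI)
  show dims: "dim_row (G\<^sup>T) = dim_row (M\<^sup>T)" "dim_col (G\<^sup>T) = dim_col (M\<^sup>T)"
    using assms unfolding quadratic_at_def by auto
  fix E :: "real mat" assume E: "E \<in> carrier_mat (dim_row (M\<^sup>T)) (dim_col (M\<^sup>T))"
  then have "E\<^sup>T \<in> carrier_mat (dim_row M) (dim_col M)" by simp
  then obtain c where "\<forall>t. \<phi> (M + t \<cdot>\<^sub>m E\<^sup>T) = \<phi> M + frob_inner G (E\<^sup>T) * t + c * t ^ 2"
    using assms unfolding quadratic_at_def by blast
  moreover have "frob_inner G (E\<^sup>T) = frob_inner (G\<^sup>T) E"
    using frob_inner_transpose[of "G\<^sup>T" E] dims E by simp
  moreover have "(M\<^sup>T + t \<cdot>\<^sub>m E)\<^sup>T = M + t \<cdot>\<^sub>m E\<^sup>T" for t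
    using E by (simp add: transpose_add_dim transpose_smult_dim)
  ultimately show "\<exists>c. \<forall>t. \<phi> ((M\<^sup>T + t \<cdot>\<^sub>m E)\<^sup>T) = \<phi> ((M\<^sup>T)\<^sup>T) + frob_inner (G\<^sup>T) E * t + c * t ^ 2"
    by auto
qed

lemma gradient_zero_if_heads_degenerate:
  assumes W: "local_min h d \<phi> W" and G: "quadratic_at \<phi> (chain d W 0 h) G" and h: "1 \<le> h"
    and dich: "\<And>j. 1 \<le> j \<Longrightarrow> j < h \<Longrightarrow> has_kernel ((chain d W 0 j)\<^sup>T) \<or> has_left_inverse (chain d W 0 j)"
  shows "G = 0\<^sub>m (d h) (d 0)"
proof -
  have Wp: "W \<in> dln_params h d" using W unfolding local_min_def by auto
  let ?d = "\<lambda>i. d (h - i)" and ?V = "reverse_params h W"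
  have "G\<^sup>T = 0\<^sub>m (?d h) (?d 0)"
  proof (rule gradient_zero_if_tails_degenerate[OF local_min_reverse[OF W] _ h])
    show "quadratic_at (\<lambda>M. \<phi> (M\<^sup>T)) (chain ?d ?V 0 h) (G\<^sup>T)"
      using quadratic_at_transpose[OF G] chain_reverse[OF Wp, of 0 h] by simp
    fix j assume j: "1 \<le> j" "j < h"
    then show "has_kernel (chain ?d ?V j h) \<or> has_left_inverse ((chain ?d ?V j h)\<^sup>T)"
      using dich[of "h - j"] chain_reverse[OF Wp, of j h] by simp
  qed
  from arg_cong[OF this, of transpose_mat] show ?thesis by simp
qed

section \<open>The square loss and the bottleneck\<close>

text \<open>
  If all entries differ by less than \<open>\<delta>\<close>, the Euclidean distance is at most \<open>\<delta> sqrt N\<close>, where \<open>N\<close> is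
  the number of parameters.
\<close>

lemma local_min_from_dln:
  assumes W: "dln_local_min h d X Y W" and X: "dim_row X = d 0"
  shows "local_min h d (loss X Y) W"
proof -
  obtain \<epsilon> where Wp: "W \<in> dln_params h d" and \<epsilon>: "0 < \<epsilon>"
    "\<And>V. V \<in> dln_params h d \<Longrightarrow> dln_dist h V W < \<epsilon> \<Longrightarrow> dln_loss h X Y W \<le> dln_loss h X Y V"
    using W unfolding dln_local_min_def by auto
  have loss: "dln_loss h X Y V = loss X Y (chain d V 0 h)" if "V \<in> dln_params h d" for V
    unfolding dln_loss_def loss_def frob_norm_sq using dln_output_chain[OF that, of h X] X by simp
  define N where "N = (\<Sum>i = 1..h. real (d i * d (i - 1)))"
  have N: "0 \<le> N" unfolding N_def by (intro sum_nonneg) auto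
  define \<delta> where "\<delta> = \<epsilon> / (sqrt N + 1)"
  have sN: "0 < sqrt N + 1" using N by (simp add: add_nonneg_pos)
  then have \<delta>: "0 < \<delta>" using \<epsilon>(1) by (simp add: \<delta>_def)
  have "dln_dist h V W < \<epsilon>" if V: "V \<in> dln_params h d" and nr: "near h d \<delta> W V" for V
  proof -
    have "(\<Sum>i = 1..h. (frob_norm (V i - W i))\<^sup>2) \<le> (\<Sum>i = 1..h. real (d i * d (i - 1)) * \<delta>\<^sup>2)"
    proof (rule sum_mono)
      fix i assume i: "i \<in> {1..h}"
      have "(frob_norm (V i - W i))\<^sup>2 = (\<Sum>a<d i. \<Sum>b<d (i - 1). (V i $$ (a, b) - W i $$ (a, b))\<^sup>2)"
        unfolding frob_norm_sq frob_inner_def using params_dim[OF Wp, of i] i by (simp add: power2_eq_square)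
      also have "\<dots> \<le> (\<Sum>a<d i. \<Sum>b<d (i - 1). \<delta>\<^sup>2)"
      proof (intro sum_mono)
        fix a b assume "a \<in> {..<d i}" "b \<in> {..<d (i - 1)}"
        then have "\<bar>V i $$ (a, b) - W i $$ (a, b)\<bar> < \<delta>" using nr i unfolding near_def by auto
        then show "(V i $$ (a, b) - W i $$ (a, b))\<^sup>2 \<le> \<delta>\<^sup>2"
          using \<delta> by (intro abs_le_square_iff[THEN iffD1]) auto
      qed
      also have "\<dots> = real (d i * d (i - 1)) * \<delta>\<^sup>2" by simp
      finally show "(frob_norm (V i - W i))\<^sup>2 \<le> real (d i * d (i - 1)) * \<delta>\<^sup>2" .
    qed
    also have "\<dots> = N * \<delta>\<^sup>2" by (simp add: N_def sum_distrib_right)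
    finally have "dln_dist h V W \<le> sqrt (N * \<delta>\<^sup>2)" unfolding dln_dist_def by (rule real_sqrt_le_mono)
    also have "\<dots> = sqrt N * \<delta>" using \<delta> by (simp add: real_sqrt_mult)
    also have "\<dots> < (sqrt N + 1) * \<delta>" using \<delta> by simp
    also have "\<dots> = \<epsilon>" using sN by (simp add: \<delta>_def)
    finally show ?thesis .
  qed
  then show ?thesis
    unfolding local_min_def using Wp \<delta> \<epsilon>(2) loss by (metis (no_types, lifting))
qed

lemma quadratic_at_loss:
  assumes "dim_col M = dim_row X" "dim_row Y = dim_row M" "dim_col Y = dim_col X"
  shows "quadratic_at (loss X Y) M ((M * X - Y) * X\<^sup>T)"
  unfolding quadratic_at_def
proof (intro conjI ballI)
  fix E :: "real mat" assume "E \<in> carrier_mat (dim_row M) (dim_col M)"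
  then have [simp]: "dim_row E = dim_row M" "dim_col E = dim_col M" by auto
  have "loss X Y (M + t \<cdot>\<^sub>m E) = loss X Y M + frob_inner ((M * X - Y) * X\<^sup>T) E * t + 1 / 2 * frob_inner (E * X) (E * X) * t ^ 2" for t
    using assms by (simp add: loss_expand frob_inner_linear smult_mult_dim power2_eq_square mult_ac)
  then show "\<exists>c. \<forall>t. loss X Y (M + t \<cdot>\<^sub>m E) = loss X Y M + frob_inner ((M * X - Y) * X\<^sup>T) E * t + c * t ^ 2"
    by blast
qed (use assms in auto)

lemma loss_minimal_if_gradient_zero:
  assumes "dim_col M = dim_row X" "dim_row Y = dim_row M" "dim_col Y = dim_col X"
    "dim_row N = dim_row M" "dim_col N = dim_col M"
    and G: "(M * X - Y) * X\<^sup>T = 0\<^sub>m (dim_row M) (dim_col M)"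
  shows "loss X Y M \<le> loss X Y N"
proof -
  have "N = M + (N - M)" using assms by (intro eq_matI) auto
  then have "loss X Y N = loss X Y M + 1 / 2 * frob_inner ((N - M) * X) ((N - M) * X)"
    using loss_expand[of M X Y "N - M"] assms by (simp add: frob_inner_zero_left)
  then show ?thesis by simp
qed

text \<open>
  By hypothesis every hidden layer narrower than the output comes no later than every hidden layer
  narrower than the input. If both kinds occur, at \<open>b\<close> and \<open>a\<close>, then one of these two layers is of both
  kinds: otherwise \<open>d b \<ge> d 0 > d a \<ge> d h > d b\<close>.
\<close>

lemma bottleneck_cases:
  fixes d :: "nat \<Rightarrow> nat"
  assumes "\<not> (\<exists>p1 p2. 1 \<le> p1 \<and> p1 < p2 \<and> p2 \<le> h - 1 \<and> d h > d p2 \<and> d 0 > d p1)"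
  obtains "\<And>j. 1 \<le> j \<Longrightarrow> j < h \<Longrightarrow> d h \<le> d j"
  | "\<And>j. 1 \<le> j \<Longrightarrow> j < h \<Longrightarrow> d 0 \<le> d j"
  | p where "1 \<le> p" "p < h" "d p < d h" "d p < d 0"
      "\<And>j. 1 \<le> j \<Longrightarrow> j < p \<Longrightarrow> d 0 \<le> d j" "\<And>j. p < j \<Longrightarrow> j < h \<Longrightarrow> d h \<le> d j"
proof -
  have order: "b \<le> a" if "1 \<le> a" "a < h" "d a < d 0" "1 \<le> b" "b < h" "d b < d h" for a b
    using assms that by (metis (no_types, lifting) One_nat_def Suc_pred leI less_Suc_eq_le less_le_trans not_less_zero zero_less_iff_neq_zero)
  consider "\<And>j. 1 \<le> j \<Longrightarrow> j < h \<Longrightarrow> d h \<le> d j" | "\<And>j. 1 \<le> j \<Longrightarrow> j < h \<Longrightarrow> d 0 \<le> d j"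
    | a b where "1 \<le> a" "a < h" "d a < d 0" "1 \<le> b" "b < h" "d b < d h"
    by (meson not_le)
  then show thesis
  proof cases
    case 3
    have "\<exists>p. 1 \<le> p \<and> p < h \<and> d p < d h \<and> d p < d 0"
    proof (cases "d b < d 0")
      case True
      then show ?thesis using 3 by auto
    next
      case False
      then have "d a < d h" using 3 by linarith
      then show ?thesis using 3 by auto
    qed
    then obtain p where p: "1 \<le> p" "p < h" "d p < d h" "d p < d 0" by auto
    show thesis
    proof (rule that(3)[OF p])
      fix j assume "1 \<le> j" "j < p"
      then show "d 0 \<le> d j" using order[of j p] p by (meson leD le_less_linear less_trans)
    next
      fix j assume "p < j" "j < h"
      then show "d h \<le> d j" using order[of p j] p by (meson leD le_less_linear less_imp_le_nat less_le_trans)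
    qed
  qed (use that in blast)+
qed

text \<open>
  Write \<open>A = W h * T\<close> and \<open>B = S * W 1\<close>, and let \<open>L A = 1\<close> and \<open>B R\<^sup>T = 1\<close>. The variations
  \<open>dA (L W h)\<close> of \<open>W h\<close> and \<open>W 1 (R\<^sup>T dB)\<close> of \<open>W 1\<close> induce exactly the variations \<open>dA\<close> and \<open>dB\<close>, so the
  two-layer theorem applies to \<open>(A, B)\<close>.
\<close>

lemma full_rank_bottleneck_minimum:
  assumes W: "local_min h d (loss X Y) W" and p: "1 \<le> p" "p < h" "0 < d p"
    and dims: "dim_row X = d 0" "dim_row Y = d h" "dim_col Y = dim_col X"
    and A: "has_left_inverse (chain d W p h)" and B: "has_left_inverse ((chain d W 0 p)\<^sup>T)"
    and M: "A' \<in> carrier_mat (d h) (d p)" "B' \<in> carrier_mat (d p) (d 0)"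
  shows "loss X Y (chain d W 0 h) \<le> loss X Y (A' * B')"
proof -
  note [simp del] = One_nat_def
  obtain \<epsilon> where Wp: "W \<in> dln_params h d" and \<epsilon>: "0 < \<epsilon>"
    "\<And>V. V \<in> dln_params h d \<Longrightarrow> near h d \<epsilon> W V \<Longrightarrow> loss X Y (chain d W 0 h) \<le> loss X Y (chain d V 0 h)"
    using W unfolding local_min_def by auto
  let ?A = "chain d W p h" and ?B = "chain d W 0 p" and ?T = "chain d W p (h - 1)" and ?S = "chain d W 1 p"
  have [simp]: "dim_row ?A = d h" "dim_col ?A = d p" "dim_row ?B = d p" "dim_col ?B = d 0"
    "dim_row ?T = d (h - 1)" "dim_col ?T = d p" "dim_row ?S = d p" "dim_col ?S = d 1"
    "dim_row (W 1) = d 1" "dim_col (W 1) = d 0" "dim_row (W h) = d h" "dim_col (W h) = d (h - 1)"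
    using chain_dim[OF Wp] params_dim[OF Wp] p by auto
  have A_eq: "?A = W h * ?T" using chain_drop_last[of p h] p by simp
  have B_eq: "?B = ?S * W 1" using chain_drop_first[OF Wp, of 0 p] p by (simp add: One_nat_def)
  have AB: "chain d W 0 h = ?A * ?B" using p by (intro chain_split[OF Wp]) auto
  obtain L where L: "L \<in> carrier_mat (d p) (d h)" "L * ?A = 1\<^sub>m (d p)" "(?A * L)\<^sup>T = ?A * L"
    using symmetric_left_inverse_or_kernel[of ?A] left_inverse_no_kernel[OF A] by auto
  obtain R where R: "R \<in> carrier_mat (d p) (d 0)" "R * ?B\<^sup>T = 1\<^sub>m (d p)"
    using B unfolding has_left_inverse_def by auto
  note [simp] = carrier_matD[OF L(1)] carrier_matD[OF R(1)]
  have BR: "?B * R\<^sup>T = 1\<^sub>m (d p)"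
    using arg_cong[OF R(2), of transpose_mat] by (simp add: transpose_mult_dim[of R])
  interpret two_layer_minimum ?A ?B X Y L
  proof
    fix dA dB :: "real mat" assume dA: "dA \<in> carrier_mat (dim_row ?A) (dim_col ?A)" and dB: "dB \<in> carrier_mat (dim_row ?B) (dim_col ?B)"
    note [simp] = carrier_matD[OF dA, simplified] carrier_matD[OF dB, simplified]
    let ?E = "dA * (L * W h)" and ?F = "W 1 * (R\<^sup>T * dB)"
    have E: "?E \<in> carrier_mat (d h) (d (h - 1))" and F: "?F \<in> carrier_mat (d 1) (d (1 - 1))"
      by (auto intro!: carrier_matI)
    obtain \<delta>1 where \<delta>1: "0 < \<delta>1" "\<And>W t. \<bar>t\<bar> < \<delta>1 \<Longrightarrow> near h d (\<epsilon> / 2) W (W(h := W h + t \<cdot>\<^sub>m ?E))"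
      using near_update[OF _ E, of "\<epsilon> / 2" h] \<epsilon>(1) by auto
    obtain \<delta>2 where \<delta>2: "0 < \<delta>2" "\<And>W t. \<bar>t\<bar> < \<delta>2 \<Longrightarrow> near h d (\<epsilon> / 2) W (W(1 := W 1 + t \<cdot>\<^sub>m ?F))"
      using near_update[OF _ F, of "\<epsilon> / 2" h] \<epsilon>(1) by auto
    have "loss X Y (?A * ?B) \<le> loss X Y ((?A + t \<cdot>\<^sub>m dA) * (?B + t \<cdot>\<^sub>m dB))" if t: "\<bar>t\<bar> < min \<delta>1 \<delta>2" for t
    proof -
      define U where "U = W(h := W h + t \<cdot>\<^sub>m ?E)"
      define V where "V = U(1 := U 1 + t \<cdot>\<^sub>m ?F)"
      have U: "U \<in> dln_params h d" unfolding U_def by (rule params_update[OF Wp E])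
      have V: "V \<in> dln_params h d" unfolding V_def by (rule params_update[OF U F])
      have "near h d \<epsilon> W V"
      proof -
        have "near h d (\<epsilon> / 2) W U" unfolding U_def by (rule \<delta>1(2)) (use t in simp)
        moreover have "near h d (\<epsilon> / 2) U V" unfolding V_def by (rule \<delta>2(2)) (use t in simp)
        ultimately show ?thesis using near_trans[of h d "\<epsilon> / 2" W U "\<epsilon> / 2" V] by simp
      qed
      then have "loss X Y (chain d W 0 h) \<le> loss X Y (chain d V 0 h)" using \<epsilon>(2)[OF V] by blast
      moreover have "chain d V 0 h = chain d V p h * chain d V 0 p"
        using p by (intro chain_split[OF V]) auto
      moreover have "chain d V p h = ?A + t \<cdot>\<^sub>m dA"
      proof -
        have "chain d V p h = V h * chain d V p (h - 1)" using chain_drop_last[of p h] p by simp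
        also have "chain d V p (h - 1) = ?T" using p by (intro chain_cong) (auto simp: U_def V_def)
        also have "V h = W h + t \<cdot>\<^sub>m ?E" using p by (simp add: U_def V_def)
        also have "(W h + t \<cdot>\<^sub>m ?E) * ?T = W h * ?T + t \<cdot>\<^sub>m (dA * (L * (W h * ?T)))" by (simp add: mat_dim)
        finally show ?thesis by (simp add: L(2) flip: A_eq)
      qed
      moreover have "chain d V 0 p = ?B + t \<cdot>\<^sub>m dB"
      proof -
        have "chain d V 0 p = chain d V 1 p * V 1" using chain_drop_first[OF V, of 0 p] p by (simp add: One_nat_def)
        also have "chain d V 1 p = ?S" using p by (intro chain_cong) (auto simp: U_def V_def)
        also have "V 1 = W 1 + t \<cdot>\<^sub>m ?F" using p by (simp add: U_def V_def)
        also have "?S * (W 1 + t \<cdot>\<^sub>m ?F) = ?S * W 1 + t \<cdot>\<^sub>m ((?S * W 1) * R\<^sup>T * dB)" by (simp add: mat_dim)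
        finally show ?thesis by (simp add: BR flip: B_eq)
      qed
      ultimately show ?thesis by (simp add: AB)
    qed
    then show "\<exists>\<epsilon>>0. \<forall>t. \<bar>t\<bar> < \<epsilon> \<longrightarrow> loss X Y (?A * ?B) \<le> loss X Y ((?A + t \<cdot>\<^sub>m dA) * (?B + t \<cdot>\<^sub>m dB))"
      using \<delta>1(1) \<delta>2(1) by (intro exI[of _ "min \<delta>1 \<delta>2"]) auto
  qed (use p dims L in simp_all)
  show ?thesis unfolding AB using M by (intro two_layer_minimum_is_global) auto
qed

theorem theorem18:
  fixes h n :: nat and d :: "nat \<Rightarrow> nat" and X Y :: "real mat"
  assumes "h \<ge> 1"
    and "n > 0"
    and "\<And>i. i \<le> h \<Longrightarrow> d i > 0"
    and "X \<in> carrier_mat (d 0) n"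
    and "Y \<in> carrier_mat (d h) n"
    and "\<not> (\<exists>p1 p2. 1 \<le> p1 \<and> p1 < p2 \<and> p2 \<le> h - 1 \<and> d h > d p2 \<and> d 0 > d p1)"
  shows "\<forall>W. dln_local_min h d X Y W \<longrightarrow> dln_global_min h d X Y W"
proof (intro allI impI)
  fix W assume W: "dln_local_min h d X Y W"
  have [simp]: "dim_row X = d 0" "dim_col X = n" "dim_row Y = d h" "dim_col Y = n" using assms(4,5) by auto
  have lm: "local_min h d (loss X Y) W" using local_min_from_dln[OF W] by simp
  then have Wp: "W \<in> dln_params h d" unfolding local_min_def by auto
  let ?M = "chain d W 0 h"
  let ?G = "(?M * X - Y) * X\<^sup>T"
  have [simp]: "dim_row ?M = d h" "dim_col ?M = d 0" using chain_dim[OF Wp, of 0 h] by auto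
  have quad: "quadratic_at (loss X Y) ?M ?G" by (rule quadratic_at_loss) simp_all
  have wide: "has_kernel (chain d W j h) \<or> has_left_inverse ((chain d W j h)\<^sup>T)" if "j < h" "d h \<le> d j" for j
    using that chain_dim[OF Wp, of j h] by (intro kernel_or_right_inverse) auto
  have tall: "has_kernel ((chain d W 0 j)\<^sup>T) \<or> has_left_inverse (chain d W 0 j)" if "j < h" "d 0 \<le> d j" for j
    using that chain_dim[OF Wp, of 0 j] kernel_or_right_inverse[of "(chain d W 0 j)\<^sup>T"] by auto
  have main: "?G = 0\<^sub>m (d h) (d 0) \<or> (\<forall>V\<in>dln_params h d. loss X Y ?M \<le> loss X Y (chain d V 0 h))"
    using assms(6)
  proof (cases rule: bottleneck_cases)
    case 1
    then show ?thesis using gradient_zero_if_tails_degenerate[OF lm quad assms(1)] wide by blast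
  next
    case 2
    then show ?thesis using gradient_zero_if_heads_degenerate[OF lm quad assms(1)] tall by blast
  next
    case (3 p)
    note p = 3
    let ?A = "chain d W p h" and ?B = "chain d W 0 p"
    consider "has_kernel ?A" | "has_kernel (?B\<^sup>T)" | "has_left_inverse ?A" "has_left_inverse (?B\<^sup>T)"
      using left_inverse_or_kernel by blast
    then show ?thesis
    proof cases
      case 1
      note ker = this
      \<comment> \<open>Layer \<open>j\<close> is wider than the bottleneck, so the map between them already has a kernel.\<close>
      have "has_kernel (chain d W j h)" if j: "1 \<le> j" "j < p" for j
      proof -
        have "has_kernel (chain d W j p)"
          using wide_has_kernel[of "chain d W j p"] chain_dim[OF Wp, of j p] p(2,4) p(5)[OF j] j by simp
        then show ?thesis
          using has_kernel_mult[of ?A "chain d W j p"] chain_split[OF Wp, of j p h] chain_dim[OF Wp] p(2) j by simp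
      qed
      then have "has_kernel (chain d W j h) \<or> has_left_inverse ((chain d W j h)\<^sup>T)" if "1 \<le> j" "j < h" for j
        using ker wide p(6) that by (metis linorder_neqE_nat)
      then show ?thesis using gradient_zero_if_tails_degenerate[OF lm quad assms(1)] by blast
    next
      case 2
      note ker = this
      have "has_kernel ((chain d W 0 j)\<^sup>T)" if j: "p < j" "j < h" for j
      proof -
        have "has_kernel ((chain d W p j)\<^sup>T)"
          using wide_has_kernel[of "(chain d W p j)\<^sup>T"] chain_dim[OF Wp, of p j] p(3) p(6)[OF j] j by simp
        then show ?thesis
          using has_kernel_mult[of "?B\<^sup>T" "(chain d W p j)\<^sup>T"] chain_split[OF Wp, of 0 p j] chain_dim[OF Wp] j
          by (simp add: transpose_mult_dim)
      qed
      then have "has_kernel ((chain d W 0 j)\<^sup>T) \<or> has_left_inverse (chain d W 0 j)" if "1 \<le> j" "j < h" for j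
        using ker tall p(5) that by (metis linorder_neqE_nat)
      then show ?thesis using gradient_zero_if_heads_degenerate[OF lm quad assms(1)] by blast
    next
      case 3
      note full = this
      have "loss X Y ?M \<le> loss X Y (chain d V 0 h)" if V: "V \<in> dln_params h d" for V
      proof -
        have "loss X Y ?M \<le> loss X Y (chain d V p h * chain d V 0 p)"
          using p(1,2) assms(3)[of p] chain_dim[OF V] full
          by (intro full_rank_bottleneck_minimum[OF lm p(1,2)]) (auto intro!: carrier_matI)
        then show ?thesis using chain_split[OF V, of 0 p h] p(2) by simp
      qed
      then show ?thesis by blast
    qed
  qed
  then have "loss X Y ?M \<le> loss X Y (chain d V 0 h)" if V: "V \<in> dln_params h d" for V
    using loss_minimal_if_gradient_zero[of ?M X Y "chain d V 0 h"] chain_dim[OF V, of 0 h] V by auto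
  moreover have "dln_loss h X Y V = loss X Y (chain d V 0 h)" if "V \<in> dln_params h d" for V
    unfolding dln_loss_def loss_def frob_norm_sq using dln_output_chain[OF that, of h X] by simp
  ultimately show "dln_global_min h d X Y W"
    unfolding dln_global_min_def using Wp by auto
qed

end
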